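(* Let $X,Y$ be Banach spaces, $T$ an arbitrary index set, $f:X\to(-\infty,\infty]$, $g_t:X\to(-\infty,\infty]$ ($t\in T$) and $h:X\to Y$. Let $\bar x$ be a local minimizer of the problem $$\text{minimize } f(x)\ \text{ subject to } g_t(x)\le 0\ (t\in T),\ h(x)=0,$$ let the standing assumptions (SA) hold at $\bar x$, and let the constraint system satisfy the PMFCQ at $\bar x$. Suppose further that the functions $g_t$, $t\in T$, are uniformly Fréchet differentiable at $\bar x$ and that $f$ is Fréchet differentiable at $\bar x$. Then $$0\in\nabla f(\bar x)+\Big(\bigcap_{\varepsilon>0}\mathrm{cl}^*\,\mathrm{cone}\{\nabla g_t(\bar x): t\in T_\varepsilon(\bar x)\}\Big)+\nabla h(\bar x)^*(Y^* ).$$ If in addition the NFMCQ holds at $\bar x$, then there exist multipliers $\lambda\in\widetilde{\mathbb R}^T_+$ and $y^*\in Y^*$ satisfying $$0=\nabla f(\bar x)+\sum_{t\in T(\bar x)}\lambda_t\nabla g_t(\bar x)+\nabla h(\bar x)^*y^*.$$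
   Context: $X^*,Y^*$ are the topological duals, $\langle\cdot,\cdot\rangle$ is the canonical pairing, $\mathbb B_r(x)$ is the closed ball of radius $r$ centered at $x$. For a set $S$, $\mathrm{cone}\,S$ is the convex cone generated by $S\cup\{0\}$; $\mathrm{cl}^*$ is the closure in the weak$^*$ topology. $\nabla h(\bar x)^*:Y^*\to X^*$ is the adjoint of $\nabla h(\bar x)$. $\widetilde{\mathbb R}^T_+$ is the set of $\lambda=(\lambda_t)_{t\in T}$ with $\lambda_t\ge0$ for all $t$ and $\lambda_t\ne0$ for only finitely many $t\in T$. Standing assumptions (SA) at $\bar x$: each $g_t$, $t\in T$, is Fréchet differentiable at $\bar x$; the set $\{\nabla g_t(\bar x): t\in T\}$ is bounded in $X^*$; $h$ is strictly differentiable at $\bar x$, i.e. there is a continuous linear operator $\nabla h(\bar x):X\to Y$ with $\lim_{x,x'\to\bar x}\frac{h(x)-h(x')-\nabla h(\bar x)(x-x')}{\|x-x'\|}=0$. Uniform Fréchet differentiability of $\{g_t\}_{t\in T}$ at $\bar x$: $s(\eta):=\sup_{t\in T}\sup_{x\in \mathbb B_\eta(\bar x),\,x\ne\bar x}\frac{|g_t(x)-g_t(\bar x)-\langle\nabla g_t(\bar x),x-\bar x\rangle|}{\|x-\bar x\|}\to0$ as $\eta\downarrow0$. $T(\bar x):=\{t\in T: g_t(\bar x)=0\}$ and $T_\varepsilon(\bar x):=\{t\in T: g_t(\bar x)\ge-\varepsilon\}$. PMFCQ at $\bar x$: $\nabla h(\bar x)$ is surjective and there is $\tilde x\in X$ with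 $\nabla h(\bar x)\tilde x=0$ and $\inf_{\varepsilon>0}\sup_{t\in T_\varepsilon(\bar x)}\langle\nabla g_t(\bar x),\tilde x\rangle<0$ (with $\sup\emptyset=-\infty$). NFMCQ at $\bar x$: the set $\mathrm{cone}\{(\nabla g_t(\bar x),\langle\nabla g_t(\bar x),\bar x\rangle-g_t(\bar x)): t\in T\}$ is weak$^*$ closed in $X^*\times\mathbb R$. *)

theory Defs
  imports "HOL-Analysis.Analysis"
begin

text \<open>
  The dual of a real Banach space is the type of bounded linear functionals
  \<open>'a \<Rightarrow>\<^sub>L real\<close>. For scalar-valued operators the strong operator topology
  (pointwise convergence) is the weak* topology.
\<close>

abbreviation weak_star :: "('a::real_normed_vector \<Rightarrow>\<^sub>L real) topology"
  where "weak_star \<equiv> strong_operator_topology"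

definition dual_adjoint ::
    "('a::real_normed_vector \<Rightarrow>\<^sub>L 'b::real_normed_vector) \<Rightarrow> ('b \<Rightarrow>\<^sub>L real) \<Rightarrow> ('a \<Rightarrow>\<^sub>L real)"
  where "dual_adjoint A y = y o\<^sub>L A"

text \<open>
  Frechet differentiability of an extended-real-valued function: the difference quotient can
  only converge if the function is finite near the point, so finiteness there is part of the
  definition.
\<close>

definition ereal_has_frechet_derivative ::
    "('a::real_normed_vector \<Rightarrow> ereal) \<Rightarrow> ('a \<Rightarrow>\<^sub>L real) \<Rightarrow> 'a \<Rightarrow> bool"
  where "ereal_has_frechet_derivative \<phi> D x \<longleftrightarrow>
    (\<forall>\<^sub>F z in nhds x. \<bar>\<phi> z\<bar> \<noteq> \<infinity>) \<and>
    ((\<lambda>z. real_of_ereal (\<phi> z)) has_derivative blinfun_apply D) (at x)"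

definition has_strict_derivative ::
    "('a::real_normed_vector \<Rightarrow> 'b::real_normed_vector) \<Rightarrow> ('a \<Rightarrow>\<^sub>L 'b) \<Rightarrow> 'a \<Rightarrow> bool"
  where "has_strict_derivative h D x \<longleftrightarrow>
    ((\<lambda>(u, v). (h u - h v - blinfun_apply D (u - v)) /\<^sub>R norm (u - v)) \<longlongrightarrow> 0)
      (at (x, x) within {(u, v). u \<noteq> v})"

text \<open>
  Throughout, \<open>T\<close> is the index set, and \<open>Dg t\<close>, \<open>Dh\<close> stand for the derivatives of
  \<open>g t\<close>, \<open>h\<close> at the reference point \<open>x\<close>; that they are these derivatives is what
  \<open>standing_assumptions\<close> says.
\<close>

definition feasible_set ::
    "'t set \<Rightarrow> ('t \<Rightarrow> 'a \<Rightarrow> ereal) \<Rightarrow> ('a \<Rightarrow> 'b::zero) \<Rightarrow> 'a set"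
  where "feasible_set T g h = {x. (\<forall>t\<in>T. g t x \<le> 0) \<and> h x = 0}"

definition local_minimizer_on ::
    "('a::topological_space \<Rightarrow> ereal) \<Rightarrow> 'a set \<Rightarrow> 'a \<Rightarrow> bool"
  where "local_minimizer_on f S x \<longleftrightarrow>
    x \<in> S \<and> (\<exists>U. open U \<and> x \<in> U \<and> (\<forall>z\<in>S \<inter> U. f x \<le> f z))"

definition standing_assumptions ::
    "'t set \<Rightarrow> ('t \<Rightarrow> 'a::real_normed_vector \<Rightarrow> ereal) \<Rightarrow> ('t \<Rightarrow> 'a \<Rightarrow>\<^sub>L real) \<Rightarrow>
     ('a \<Rightarrow> 'b::real_normed_vector) \<Rightarrow> ('a \<Rightarrow>\<^sub>L 'b) \<Rightarrow> 'a \<Rightarrow> bool"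
  where "standing_assumptions T g Dg h Dh x \<longleftrightarrow>
    (\<forall>t\<in>T. ereal_has_frechet_derivative (g t) (Dg t) x) \<and>
    bounded (Dg ` T) \<and>
    has_strict_derivative h Dh x"

text \<open>
  The supremum is that of a family of nonnegative extended reals. Taking the maximum with 0
  only matters for an empty family (no index, or a trivial space), whose supremum in
  \<open>ereal\<close> would be \<open>-\<infinity>\<close>.
\<close>

definition frechet_modulus ::
    "'t set \<Rightarrow> ('t \<Rightarrow> 'a::real_normed_vector \<Rightarrow> ereal) \<Rightarrow> ('t \<Rightarrow> 'a \<Rightarrow>\<^sub>L real) \<Rightarrow>
     'a \<Rightarrow> real \<Rightarrow> ereal"
  where "frechet_modulus T g Dg x \<eta> =
    max 0 (SUP t\<in>T. SUP z\<in>cball x \<eta> - {x}.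
      \<bar>g t z - g t x - ereal (blinfun_apply (Dg t) (z - x))\<bar> / ereal (norm (z - x)))"

definition uniformly_frechet_differentiable ::
    "'t set \<Rightarrow> ('t \<Rightarrow> 'a::real_normed_vector \<Rightarrow> ereal) \<Rightarrow> ('t \<Rightarrow> 'a \<Rightarrow>\<^sub>L real) \<Rightarrow> 'a \<Rightarrow> bool"
  where "uniformly_frechet_differentiable T g Dg x \<longleftrightarrow>
    (frechet_modulus T g Dg x \<longlongrightarrow> 0) (at_right 0)"

definition active_set :: "'t set \<Rightarrow> ('t \<Rightarrow> 'a \<Rightarrow> ereal) \<Rightarrow> 'a \<Rightarrow> 't set"
  where "active_set T g x = {t\<in>T. g t x = 0}"

definition eps_active_set :: "'t set \<Rightarrow> ('t \<Rightarrow> 'a \<Rightarrow> ereal) \<Rightarrow> 'a \<Rightarrow> real \<Rightarrow> 't set"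
  where "eps_active_set T g x \<epsilon> = {t\<in>T. g t x \<ge> ereal (- \<epsilon>)}"

text \<open>
  In \<open>ereal\<close> the supremum over the empty set is \<open>-\<infinity>\<close>, as the perturbed
  Mangasarian-Fromovitz condition requires.
\<close>

definition PMFCQ ::
    "'t set \<Rightarrow> ('t \<Rightarrow> 'a::real_normed_vector \<Rightarrow> ereal) \<Rightarrow> ('t \<Rightarrow> 'a \<Rightarrow>\<^sub>L real) \<Rightarrow>
     ('a \<Rightarrow>\<^sub>L 'b::real_normed_vector) \<Rightarrow> 'a \<Rightarrow> bool"
  where "PMFCQ T g Dg Dh x \<longleftrightarrow>
    surj (blinfun_apply Dh) \<and>
    (\<exists>d. blinfun_apply Dh d = 0 \<and>
      (INF \<epsilon>\<in>{0<..}. SUP t\<in>eps_active_set T g x \<epsilon>. ereal (blinfun_apply (Dg t) d)) < 0)"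

text \<open>
  \<open>convex_cone hull S\<close> always contains 0 (every \<open>convex_cone\<close> is nonempty), so it is the
  convex cone generated by \<open>S \<union> {0}\<close>. Under the standing assumptions \<open>g t x\<close> is finite,
  hence \<open>real_of_ereal\<close> is harmless.
\<close>

definition NFMCQ ::
    "'t set \<Rightarrow> ('t \<Rightarrow> 'a::real_normed_vector \<Rightarrow> ereal) \<Rightarrow> ('t \<Rightarrow> 'a \<Rightarrow>\<^sub>L real) \<Rightarrow> 'a \<Rightarrow> bool"
  where "NFMCQ T g Dg x \<longleftrightarrow>
    closedin (prod_topology weak_star euclideanreal)
      (convex_cone hull ((\<lambda>t. (Dg t, blinfun_apply (Dg t) x - real_of_ereal (g t x))) ` T))"

definition nonneg_finite_multipliers :: "'t set \<Rightarrow> ('t \<Rightarrow> real) set"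
  where "nonneg_finite_multipliers T =
    {l. (\<forall>t\<in>T. 0 \<le> l t) \<and> finite {t\<in>T. l t \<noteq> 0}}"

end

theory Submission
  imports Defs
begin

text \<open>
  Write \<open>x\<close> for the minimizer. The proof passes through one convex cone \<open>C\<close> in the primal space:
  the directions \<open>d\<close> for which some \<open>\<epsilon> > 0\<close> satisfies \<open>Dg t d \<le> 0\<close> for all \<open>\<epsilon>\<close>-active \<open>t\<close>.

  \<^emph>\<open>Primal condition.\<close> If \<open>d \<in> C\<close> and \<open>Dh d = 0\<close>, then \<open>Df d \<ge> 0\<close>
  (\<open>derivative_nonneg_on_eps_linearized_cone\<close>). Adding a small multiple of the direction supplied
  by the constraint qualification makes the inequalities uniformly strict. By Lyusternik's theorem
  (\<open>Lyusternik_tangent\<close>) the perturbed direction is tangent to the level set \<open>h = 0\<close>, and uniform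
  differentiability makes nearby points on the level set feasible for all constraints at once.

  \<^emph>\<open>Dualization.\<close> The linear program of minimizing \<open>Df\<close> over \<open>C\<close> subject to \<open>Dh d = y\<close> has a
  sublinear, Lipschitz value function of \<open>y\<close>, because \<open>C\<close> has interior points in the kernel of the
  surjective operator \<open>Dh\<close>. A linear minorant \<open>z\<close> from the Hahn-Banach theorem satisfies
  \<open>z (Dh d) \<le> Df d\<close> on \<open>C\<close>. So \<open>v = z \<circ> Dh - Df\<close> is nonpositive on \<open>C\<close>, and for every \<open>\<epsilon>\<close> the
  bipolar theorem (\<open>weak_star_bipolar\<close>) puts \<open>v\<close> into the weak* closed cone generated by the
  \<open>\<epsilon>\<close>-active gradients. Dualizing on \<open>C\<close>, rather than separately for each \<open>\<epsilon>\<close>, produces one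
  multiplier that serves every \<open>\<epsilon>\<close>.

  \<^emph>\<open>Exact multipliers.\<close> The strict direction bounds the total weight of a conic combination of
  \<open>\<epsilon>\<close>-active gradients by a weak* continuous quantity. Replacing \<open>v\<close> by such a combination
  therefore costs only \<open>O(\<epsilon>)\<close> in complementary slackness, and \<open>(v, v x)\<close> lies in the closure of
  the cone in the second qualification condition. When that cone is closed, \<open>(v, v x)\<close> is a finite
  conic combination of its generators, and its second component expresses complementary slackness.
\<close>

section \<open>Sublinear functionals and the Hahn-Banach theorem\<close>

definition sublinear :: "('v::real_vector \<Rightarrow> real) \<Rightarrow> bool"
  where "sublinear p \<longleftrightarrow>
    (\<forall>x y. p (x + y) \<le> p x + p y) \<and> (\<forall>c\<ge>0. \<forall>x. p (c *\<^sub>R x) = c * p x)"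

lemma sublinear_add: "sublinear p \<Longrightarrow> p (x + y) \<le> p x + p y"
  by (simp add: sublinear_def)

lemma sublinear_scale: "sublinear p \<Longrightarrow> c \<ge> 0 \<Longrightarrow> p (c *\<^sub>R x) = c * p x"
  by (simp add: sublinear_def)

lemma sublinear_0: "sublinear p \<Longrightarrow> p 0 = 0"
  using sublinear_scale[of p 0 0] by simp

lemma sublinear_minus: "sublinear p \<Longrightarrow> - p (- x) \<le> p x"
  using sublinear_add[of p x "- x"] sublinear_0[of p] by simp

text \<open>
  Partial minimization preserves sublinearity. The family \<open>S\<close> is set-valued, with its index set
  depending on the point, so that the one rule covers infima of chains of sublinear functionals,
  seminorm distances to a cone, and values of linear programs under perturbation of the right-hand
  side.
\<close>

lemma sublinear_Inf:
  fixes S :: "'v::real_vector \<Rightarrow> real set"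
  assumes ne: "\<And>x. S x \<noteq> {}" and bdd: "\<And>x. bdd_below (S x)"
    and add: "\<And>x y s t. s \<in> S x \<Longrightarrow> t \<in> S y \<Longrightarrow> \<exists>r\<in>S (x + y). r \<le> s + t"
    and scale: "\<And>x s c. s \<in> S x \<Longrightarrow> c > 0 \<Longrightarrow> \<exists>r\<in>S (c *\<^sub>R x). r \<le> c * s"
  shows "sublinear (\<lambda>x. Inf (S x))"
proof -
  have le: "Inf (S (c *\<^sub>R x)) \<le> c * Inf (S x)" if "c > 0" for c x
  proof -
    note c = that
    have "Inf (S (c *\<^sub>R x)) / c \<le> Inf (S x)"
    proof (rule cInf_greatest[OF ne])
      fix s assume "s \<in> S x"
      then obtain r where "r \<in> S (c *\<^sub>R x)" "r \<le> c * s" using scale c by blast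
      then show "Inf (S (c *\<^sub>R x)) / c \<le> s"
        using cInf_lower[OF _ bdd, of r] c by (force simp: field_simps)
    qed
    then show ?thesis using that by (simp add: field_simps)
  qed
  \<comment> \<open>Subhomogeneity with factors above and below \<open>1\<close> excludes negative and positive values.\<close>
  have zero: "Inf (S 0) = 0"
    using le[of 2 0] le[of "1/2" 0] by simp
  have "Inf (S (c *\<^sub>R x)) = c * Inf (S x)" if c: "c \<ge> 0" for c x
  proof (cases "c = 0")
    case False
    then have "c > 0" using c by simp
    then have "c * Inf (S x) \<le> Inf (S (c *\<^sub>R x))"
      using le[of "inverse c" "c *\<^sub>R x"] by (simp add: field_simps)
    with le[OF \<open>c > 0\<close>, of x] show ?thesis by simp
  qed (simp add: zero)
  moreover have "Inf (S (x + y)) \<le> Inf (S x) + Inf (S y)" for x y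
  proof -
    have "Inf (S (x + y)) - Inf (S y) \<le> Inf (S x)"
    proof (rule cInf_greatest[OF ne])
      fix s assume s: "s \<in> S x"
      have "Inf (S (x + y)) - s \<le> Inf (S y)"
      proof (rule cInf_greatest[OF ne])
        fix t assume "t \<in> S y"
        with s obtain r where "r \<in> S (x + y)" "r \<le> s + t" using add by blast
        then show "Inf (S (x + y)) - s \<le> t"
          using cInf_lower[OF _ bdd, of r] by force
      qed
      then show "Inf (S (x + y)) - Inf (S y) \<le> s" by simp
    qed
    then show ?thesis by simp
  qed
  ultimately show ?thesis by (simp add: sublinear_def)
qed

text \<open>
  The functional \<open>q w = inf {p (w + t v) - t p v | t \<ge> 0}\<close> lowers \<open>p\<close> just enough to make it
  additive on the line spanned by \<open>v\<close>. It serves twice: a minimal sublinear functional cannot be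
  lowered, hence must be linear; and lowering \<open>p\<close> along \<open>v\<close> beforehand prescribes the value of
  the resulting linear functional at \<open>v\<close>.
\<close>

lemma sublinear_tilt:
  fixes p :: "'v::real_vector \<Rightarrow> real"
  assumes p: "sublinear p"
  obtains q where "sublinear q" "\<And>w. q w \<le> p w" "q (- v) \<le> - p v"
proof -
  define S where "S w = (\<lambda>t. p (w + t *\<^sub>R v) - t * p v) ` {0..}" for w
  have bdd: "bdd_below (S w)" for w
  proof (rule bdd_belowI[of _ "- p (- w)"])
    fix s assume "s \<in> S w"
    then obtain t where t: "t \<ge> 0" "s = p (w + t *\<^sub>R v) - t * p v" by (auto simp: S_def)
    show "- p (- w) \<le> s"
      using sublinear_add[OF p, of "w + t *\<^sub>R v" "- w"] sublinear_scale[OF p t(1), of v] t(2)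
      by simp
  qed
  show ?thesis
  proof (rule that[of "\<lambda>w. Inf (S w)"])
    show "sublinear (\<lambda>w. Inf (S w))"
    proof (rule sublinear_Inf[OF _ bdd])
      show "S x \<noteq> {}" for x by (auto simp: S_def)
      fix x y s t assume "s \<in> S x" "t \<in> S y"
      then obtain a b where a: "a \<ge> 0" "s = p (x + a *\<^sub>R v) - a * p v"
        and b: "b \<ge> 0" "t = p (y + b *\<^sub>R v) - b * p v" by (auto simp: S_def)
      have "p (x + y + (a + b) *\<^sub>R v) \<le> p (x + a *\<^sub>R v) + p (y + b *\<^sub>R v)"
        using sublinear_add[OF p, of "x + a *\<^sub>R v" "y + b *\<^sub>R v"] by (simp add: algebra_simps)
      then have "p (x + y + (a + b) *\<^sub>R v) - (a + b) * p v \<le> s + t"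
        by (simp add: a b algebra_simps)
      moreover have "p (x + y + (a + b) *\<^sub>R v) - (a + b) * p v \<in> S (x + y)"
        using a b by (auto simp: S_def)
      ultimately show "\<exists>r\<in>S (x + y). r \<le> s + t" by blast
    next
      fix x s and c :: real assume "s \<in> S x" and c: "c > 0"
      then obtain a where a: "a \<ge> 0" "s = p (x + a *\<^sub>R v) - a * p v" by (auto simp: S_def)
      have "p (c *\<^sub>R x + (c * a) *\<^sub>R v) = c * p (x + a *\<^sub>R v)"
        using sublinear_scale[OF p, of c "x + a *\<^sub>R v"] c by (simp add: algebra_simps)
      then have "p (c *\<^sub>R x + (c * a) *\<^sub>R v) - (c * a) * p v = c * s"
        by (simp add: a(2) right_diff_distrib)
      moreover have "p (c *\<^sub>R x + (c * a) *\<^sub>R v) - (c * a) * p v \<in> S (c *\<^sub>R x)"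
        using a c by (auto simp: S_def)
      ultimately show "\<exists>r\<in>S (c *\<^sub>R x). r \<le> c * s" by force
    qed
    show "Inf (S w) \<le> p w" for w
      by (rule cInf_lower[OF _ bdd]) (force simp: S_def intro: image_eqI[of _ _ 0])
    show "Inf (S (- v)) \<le> - p v"
      by (rule cInf_lower[OF _ bdd])
         (force simp: S_def sublinear_0[OF p] intro: image_eqI[of _ _ 1])
  qed
qed

text \<open>
  Zorn's lemma for the pointwise order. Chains have lower bounds because
  \<open>q w \<ge> - q (- w) \<ge> - p (- w)\<close> for every sublinear \<open>q \<le> p\<close>.
\<close>

lemma sublinear_minimal:
  fixes p :: "'v::real_vector \<Rightarrow> real"
  assumes p: "sublinear p"
  obtains m where "sublinear m" "\<And>w. m w \<le> p w"
    "\<And>q. sublinear q \<Longrightarrow> (\<And>w. q w \<le> m w) \<Longrightarrow> q = m"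
proof -
  define A where "A = {q. sublinear q \<and> (\<forall>w. q w \<le> p w)}"
  define P where "P q r \<longleftrightarrow> (\<forall>w. r w \<le> q w)" for q r :: "'v \<Rightarrow> real"
  have "\<exists>m\<in>A. \<forall>q\<in>A. P m q \<longrightarrow> q = m"
  proof (rule predicate_Zorn)
    show "partial_order_on A (relation_of P A)"
    proof (rule partial_order_on_relation_ofI)
      show "P a c" if "P a b" "P b c" for a b c
        using that unfolding P_def by (meson order_trans)
      show "a = b" if "P a b" "P b a" for a b
        using that by (auto simp: P_def intro!: ext antisym)
    qed (simp add: P_def)
    fix C assume C: "C \<in> Chains (relation_of P A)"
    show "\<exists>u\<in>A. \<forall>a\<in>C. P a u"
    proof (cases "C = {}")
      case True
      then show ?thesis using p by (auto simp: A_def)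
    next
      case False
      have CA: "q \<in> A" if "q \<in> C" for q
        using C that by (auto simp: Chains_def relation_of_def)
      have chain: "P q r \<or> P r q" if "q \<in> C" "r \<in> C" for q r
        using C that by (auto simp: Chains_def relation_of_def)
      define S where "S w = (\<lambda>q. q w) ` C" for w
      have bdd: "bdd_below (S w)" for w
      proof (rule bdd_belowI[of _ "- p (- w)"])
        fix s assume "s \<in> S w"
        then obtain q where q: "q \<in> C" "s = q w" by (auto simp: S_def)
        then have "sublinear q" "q (- w) \<le> p (- w)" using CA by (auto simp: A_def)
        then show "- p (- w) \<le> s" using sublinear_minus[of q w] q by simp
      qed
      have "sublinear (\<lambda>w. Inf (S w))"
      proof (rule sublinear_Inf[OF _ bdd])
        show "S x \<noteq> {}" for x using False by (auto simp: S_def)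
        fix x y s t assume "s \<in> S x" "t \<in> S y"
        then obtain q r where q: "q \<in> C" "s = q x" and r: "r \<in> C" "t = r y"
          by (auto simp: S_def)
        have "\<exists>m\<in>C. m x \<le> q x \<and> m y \<le> r y"
          using chain[OF q(1) r(1)] q(1) r(1) by (auto simp: P_def)
        then obtain m where m: "m \<in> C" "m x \<le> q x" "m y \<le> r y" by blast
        then have "m (x + y) \<le> s + t"
          using CA[OF m(1)] sublinear_add[of m x y] q r by (simp add: A_def)
        then show "\<exists>r\<in>S (x + y). r \<le> s + t" using m(1) by (auto simp: S_def)
      next
        fix x s and c :: real assume "s \<in> S x" and c: "c > 0"
        then obtain q where q: "q \<in> C" "s = q x" by (auto simp: S_def)
        then have "q (c *\<^sub>R x) \<le> c * s"
          using CA[OF q(1)] c sublinear_scale[of q c x] by (simp add: A_def)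
        then show "\<exists>r\<in>S (c *\<^sub>R x). r \<le> c * s" using q(1) by (auto simp: S_def)
      qed
      moreover have low: "Inf (S w) \<le> q w" if "q \<in> C" for q w
        by (rule cInf_lower[OF _ bdd]) (use that in \<open>auto simp: S_def\<close>)
      moreover have "Inf (S w) \<le> p w" for w
      proof -
        from False obtain q where "q \<in> C" by blast
        then show ?thesis using low[of q w] CA[of q] by (auto simp: A_def intro: order_trans)
      qed
      ultimately show ?thesis
        by (intro bexI[of _ "\<lambda>w. Inf (S w)"]) (auto simp: A_def P_def)
    qed
  qed
  then obtain m where m: "m \<in> A" "\<And>q. q \<in> A \<Longrightarrow> P m q \<Longrightarrow> q = m" by blast
  show ?thesis
  proof (rule that)
    show "sublinear m" "\<And>w. m w \<le> p w" using m(1) by (auto simp: A_def)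
    fix q assume q: "sublinear q" "\<And>w. q w \<le> m w"
    then have "q \<in> A" using m(1) by (auto simp: A_def intro: order_trans)
    with q show "q = m" using m(2) by (simp add: P_def)
  qed
qed

text \<open>
  Working with sublinear functionals on the whole space instead of partial linear functionals
  avoids all bookkeeping with domains: linear functionals are the minimal sublinear ones.
\<close>

theorem Hahn_Banach_sublinear:
  fixes p :: "'v::real_vector \<Rightarrow> real"
  assumes p: "sublinear p"
  obtains l where "linear l" "\<And>w. l w \<le> p w" "l v = p v"
proof -
  obtain q where q: "sublinear q" "\<And>w. q w \<le> p w" "q (- v) \<le> - p v"
    using sublinear_tilt[OF p] by metis
  obtain m where m: "sublinear m" "\<And>w. m w \<le> q w"
    and min: "\<And>r. sublinear r \<Longrightarrow> (\<And>w. r w \<le> m w) \<Longrightarrow> r = m"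
    using sublinear_minimal[OF q(1)] by metis
  have odd: "m (- w) = - m w" for w
  proof -
    obtain r where r: "sublinear r" "\<And>x. r x \<le> m x" "r (- w) \<le> - m w"
      using sublinear_tilt[OF m(1)] by metis
    then have "m (- w) \<le> - m w" using min[OF r(1,2)] by simp
    then show ?thesis using sublinear_minus[OF m(1), of w] by simp
  qed
  show ?thesis
  proof (rule that)
    show "linear m"
    proof (rule linearI)
      fix x y
      show "m (x + y) = m x + m y"
        using sublinear_add[OF m(1), of x y] sublinear_add[OF m(1), of "- x" "- y"]
          odd[of x] odd[of y] odd[of "x + y"] by simp
      show "m (c *\<^sub>R x) = c *\<^sub>R m x" for c
        using sublinear_scale[OF m(1), of c x] sublinear_scale[OF m(1), of "- c" x] odd[of "c *\<^sub>R x"]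
        by (cases "c \<ge> 0") auto
    qed
    show le: "m w \<le> p w" for w using m(2)[of w] q(2)[of w] by simp
    show "m v = p v" using m(2)[of "- v"] q(3) odd[of v] le[of v] by simp
  qed
qed

section \<open>Lagrange multipliers for convex cones\<close>

text \<open>
  The Lagrange multiplier of the conic program that minimizes \<open>\<phi>\<close> on \<open>C\<close> subject to \<open>A d = y\<close>.
  Its value function in \<open>y\<close> is sublinear, because \<open>A\<close> maps \<open>C\<close> onto the whole space and
  \<open>\<phi>\<close> is nonnegative on \<open>C \<inter> ker A\<close>; any linear functional below the value function
  is a multiplier.
\<close>

lemma linear_nonneg_on_kernel_extension:
  fixes C :: "'v::real_vector set" and A :: "'v \<Rightarrow> 'w::real_vector"
  assumes C: "convex_cone C" and A: "linear A" and onto: "A ` C = UNIV"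
    and \<phi>: "linear \<phi>" and nonneg: "\<And>d. d \<in> C \<Longrightarrow> A d = 0 \<Longrightarrow> \<phi> d \<ge> (0::real)"
  obtains z where "linear z" "\<And>d. d \<in> C \<Longrightarrow> z (A d) \<le> \<phi> d"
proof -
  define S where "S y = \<phi> ` {d \<in> C. A d = y}" for y
  have ex: "\<exists>d\<in>C. A d = y" for y using onto by (metis UNIV_I imageE)
  have bdd: "bdd_below (S y)" for y
  proof -
    \<comment> \<open>Adding a point of \<open>C\<close> over \<open>- y\<close> moves a point over \<open>y\<close> into the kernel.\<close>
    obtain d' where d': "d' \<in> C" "A d' = - y" using ex by blast
    have "- \<phi> d' \<le> \<phi> d" if "d \<in> C" "A d = y" for d
    proof -
      have "0 \<le> \<phi> (d + d')"
        using that d' by (intro nonneg convex_cone_add[OF C]) (auto simp: linear_add[OF A])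
      then show ?thesis by (simp add: linear_add[OF \<phi>])
    qed
    then show ?thesis by (intro bdd_belowI[of _ "- \<phi> d'"]) (auto simp: S_def)
  qed
  have "sublinear (\<lambda>y. Inf (S y))"
  proof (rule sublinear_Inf[OF _ bdd])
    show "S y \<noteq> {}" for y using ex[of y] by (auto simp: S_def)
    fix x y s t assume "s \<in> S x" "t \<in> S y"
    then obtain d e where "d \<in> C" "A d = x" "s = \<phi> d" "e \<in> C" "A e = y" "t = \<phi> e"
      by (auto simp: S_def)
    then have "d + e \<in> C" "A (d + e) = x + y" "\<phi> (d + e) = s + t"
      using convex_cone_add[OF C] by (auto simp: linear_add[OF A] linear_add[OF \<phi>])
    then show "\<exists>r\<in>S (x + y). r \<le> s + t" by (auto simp: S_def intro!: bexI[of _ "s + t"] image_eqI[of _ _ "d + e"])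
  next
    fix x s and c :: real assume "s \<in> S x" and c: "c > 0"
    then obtain d where "d \<in> C" "A d = x" "s = \<phi> d" by (auto simp: S_def)
    then have "c *\<^sub>R d \<in> C" "A (c *\<^sub>R d) = c *\<^sub>R x" "\<phi> (c *\<^sub>R d) = c * s"
      using convex_cone_scaleR[OF C] c by (auto simp: linear_scale[OF A] linear_scale[OF \<phi>])
    then show "\<exists>r\<in>S (c *\<^sub>R x). r \<le> c * s"
      by (auto simp: S_def intro!: bexI[of _ "c * s"] image_eqI[of _ _ "c *\<^sub>R d"])
  qed
  then obtain z where z: "linear z" "\<And>y. z y \<le> Inf (S y)"
    using Hahn_Banach_sublinear by metis
  show ?thesis
  proof (rule that[OF z(1)])
    fix d assume "d \<in> C"
    then have "Inf (S (A d)) \<le> \<phi> d" by (intro cInf_lower[OF _ bdd]) (auto simp: S_def)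
    then show "z (A d) \<le> \<phi> d" using z(2)[of "A d"] by simp
  qed
qed

section \<open>The bipolar theorem for the weak* topology\<close>

lemma functional_in_span_if_kernel_contains:
  fixes \<phi> :: "'i \<Rightarrow> 'v::real_vector \<Rightarrow> real"
  assumes "finite I" "\<And>i. i \<in> I \<Longrightarrow> linear (\<phi> i)" "linear l"
    and "\<And>x. (\<forall>i\<in>I. \<phi> i x = 0) \<Longrightarrow> l x = 0"
  shows "\<exists>c. \<forall>x. l x = (\<Sum>i\<in>I. c i * \<phi> i x)"
  using assms
proof (induction I arbitrary: l rule: finite_induct)
  case empty
  then show ?case by simp
next
  case (insert j I)
  have lj: "linear (\<phi> j)" and li: "\<And>i. i \<in> I \<Longrightarrow> linear (\<phi> i)" using insert.prems by auto
  have "\<exists>a. \<forall>x. (\<forall>i\<in>I. \<phi> i x = 0) \<longrightarrow> l x = a * \<phi> j x"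
  \<comment> \<open>On the common kernel of the functionals from \<open>I\<close>, the functional \<open>l\<close> is a multiple of
    \<open>\<phi> j\<close>: either \<open>\<phi> j\<close> vanishes there too, or the multiple is read off at one point \<open>e\<close>.\<close>
  proof (cases "\<exists>e. (\<forall>i\<in>I. \<phi> i e = 0) \<and> \<phi> j e \<noteq> 0")
    case True
    then obtain e where e: "\<forall>i\<in>I. \<phi> i e = 0" "\<phi> j e \<noteq> 0" by blast
    have "l x = (l e / \<phi> j e) * \<phi> j x" if "\<forall>i\<in>I. \<phi> i x = 0" for x
    proof -
      have "l (x - (\<phi> j x / \<phi> j e) *\<^sub>R e) = 0"
        using e that li
        by (intro insert.prems(3))
           (auto simp: linear_diff linear_scale lj)
      then show ?thesis using insert.prems(2) by (simp add: linear_diff linear_scale field_simps)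
    qed
    then show ?thesis by blast
  next
    case False
    then show ?thesis using insert.prems(3) by (intro exI[of _ 0]) auto
  qed
  then obtain a where a: "\<And>x. (\<forall>i\<in>I. \<phi> i x = 0) \<Longrightarrow> l x - a * \<phi> j x = 0" by auto
  have "linear (\<lambda>x. l x - a * \<phi> j x)"
    using linear_compose_sub[OF insert.prems(2) linear_compose_scale_right[OF lj, of a]] by simp
  from insert.IH[OF li this a] obtain c where c: "\<And>x. l x - a * \<phi> j x = (\<Sum>i\<in>I. c i * \<phi> i x)"
    by blast
  have "l x = (\<Sum>i\<in>insert j I. (c(j := a)) i * \<phi> i x)" for x
  proof -
    have "(\<Sum>i\<in>I. (c(j := a)) i * \<phi> i x) = (\<Sum>i\<in>I. c i * \<phi> i x)"
      using insert.hyps by (intro sum.cong) auto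
    then show ?thesis using c[of x] insert.hyps by simp
  qed
  then show ?case by blast
qed

lemma weak_star_nhd_contains_finite_box:
  fixes v :: "'a::real_normed_vector \<Rightarrow>\<^sub>L real"
  assumes "openin weak_star U" "v \<in> U"
  obtains F e where "finite F" "e > 0"
    "\<And>w. (\<And>d. d \<in> F \<Longrightarrow> \<bar>blinfun_apply w d - blinfun_apply v d\<bar> < e) \<Longrightarrow> w \<in> U"
proof -
  obtain V where V: "open V" "U = blinfun_apply -` V"
    using assms(1) by (auto simp: strong_operator_topology_def openin_pullback_topology)
  then have "openin (product_topology (\<lambda>_. euclidean) UNIV) V" "blinfun_apply v \<in> V"
    using assms(2) by (auto simp: open_fun_def)
  from product_topology_open_contains_basis[OF this]
  obtain X where X: "blinfun_apply v \<in> (\<Pi>\<^sub>E i\<in>UNIV. X i)" "\<And>i. open (X i)"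
      "finite {i. X i \<noteq> UNIV}" "(\<Pi>\<^sub>E i\<in>UNIV. X i) \<subseteq> V" by auto
  define F where "F = {i. X i \<noteq> UNIV}"
  have "\<exists>r>0. \<forall>y. \<bar>y - blinfun_apply v i\<bar> < r \<longrightarrow> y \<in> X i" for i
    using X(1,2) by (metis PiE_mem UNIV_I open_real_def open_dist dist_real_def)
  then obtain r where r: "\<And>i. r i > 0" "\<And>i y. \<bar>y - blinfun_apply v i\<bar> < r i \<Longrightarrow> y \<in> X i"
    by metis
  have fin: "finite F" using X(3) by (simp add: F_def)
  show ?thesis
  proof (rule that[OF fin, of "Min (insert 1 (r ` F))"])
    show "Min (insert 1 (r ` F)) > 0" using fin r(1) by (subst Min_gr_iff) auto
    fix w assume w: "\<And>d. d \<in> F \<Longrightarrow>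
      \<bar>blinfun_apply w d - blinfun_apply v d\<bar> < Min (insert 1 (r ` F))"
    have "blinfun_apply w i \<in> X i" for i
    proof (cases "i \<in> F")
      case True
      then have "Min (insert 1 (r ` F)) \<le> r i" using fin by (intro Min_le) auto
      then show ?thesis using w[OF True] r(2) by fastforce
    qed (simp add: F_def)
    then show "w \<in> U" using X(4) V(2) by (auto simp: PiE_def Pi_def extensional_def subset_iff)
  qed
qed

text \<open>
  If \<open>v\<close> is not in the closure, finitely many points \<open>d\<close> separate it from \<open>K\<close>: the seminorm
  \<open>q w = (\<Sum>d\<in>F. \<bar>w d\<bar>)\<close> has positive distance from \<open>v\<close> to \<open>K\<close>. This distance is a
  sublinear function of \<open>v\<close>, and Hahn-Banach gives a linear \<open>l\<close> that is positive at \<open>v\<close> and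
  nonpositive on \<open>K\<close>. Being bounded by \<open>q\<close>, it is a linear combination of evaluations at the
  points of \<open>F\<close>, that is, evaluation at a single point of the primal space.
\<close>

theorem weak_star_bipolar:
  fixes K :: "('a::real_normed_vector \<Rightarrow>\<^sub>L real) set"
  assumes K: "convex_cone K"
    and polar: "\<And>d. (\<And>k. k \<in> K \<Longrightarrow> blinfun_apply k d \<le> 0) \<Longrightarrow> blinfun_apply v d \<le> 0"
  shows "v \<in> weak_star closure_of K"
proof (rule ccontr)
  assume "v \<notin> weak_star closure_of K"
  then obtain U where U: "openin weak_star U" "v \<in> U" "\<And>k. k \<in> K \<Longrightarrow> k \<notin> U"
    by (auto simp: in_closure_of strong_operator_topology_topspace)
  obtain F e where F: "finite F" "e > 0"
    "\<And>w. (\<And>d. d \<in> F \<Longrightarrow> \<bar>blinfun_apply w d - blinfun_apply v d\<bar> < e) \<Longrightarrow> w \<in> U"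
    using weak_star_nhd_contains_finite_box[OF U(1,2)] by metis
  define q where "q w = (\<Sum>d\<in>F. \<bar>blinfun_apply w d\<bar>)" for w :: "'a \<Rightarrow>\<^sub>L real"
  define S where "S w = (\<lambda>k. q (w - k)) ` K" for w
  have q0: "q w \<ge> 0" for w by (simp add: q_def sum_nonneg)
  have q_add: "q (w + w') \<le> q w + q w'" for w w'
    by (auto simp: q_def sum.distrib[symmetric] blinfun.add_left intro!: sum_mono)
  have q_scale: "q (c *\<^sub>R w) = c * q w" if "c \<ge> 0" for c w
    using that by (auto simp: q_def sum_distrib_left blinfun.scaleR_left abs_mult intro!: sum.cong)
  have bdd: "bdd_below (S w)" for w by (rule bdd_belowI[of _ 0]) (auto simp: S_def q0)
  have "sublinear (\<lambda>w. Inf (S w))"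
  proof (rule sublinear_Inf[OF _ bdd])
    show "S w \<noteq> {}" for w using convex_cone_nonempty[OF K] by (auto simp: S_def)
    fix x y s t assume "s \<in> S x" "t \<in> S y"
    then obtain k k' where k: "k \<in> K" "s = q (x - k)" "k' \<in> K" "t = q (y - k')"
      by (auto simp: S_def)
    then have "q (x + y - (k + k')) \<le> s + t"
      using q_add[of "x - k" "y - k'"] by (simp add: algebra_simps)
    then show "\<exists>r\<in>S (x + y). r \<le> s + t"
      using convex_cone_add[OF K] k by (auto simp: S_def)
  next
    fix x s and c :: real assume "s \<in> S x" and c: "c > 0"
    then obtain k where k: "k \<in> K" "s = q (x - k)" by (auto simp: S_def)
    then have "q (c *\<^sub>R x - c *\<^sub>R k) \<le> c * s"
      using q_scale[of c "x - k"] c by (simp add: algebra_simps)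
    then show "\<exists>r\<in>S (c *\<^sub>R x). r \<le> c * s"
      using convex_cone_scaleR[OF K, of c k] k c by (auto simp: S_def)
  qed
  then obtain l where l: "linear l" "\<And>w. l w \<le> Inf (S w)" "l v = Inf (S v)"
    using Hahn_Banach_sublinear by metis
  have l_le: "l w \<le> q (w - k)" if "k \<in> K" for w k
  proof -
    have "Inf (S w) \<le> q (w - k)" using that by (intro cInf_lower[OF _ bdd]) (auto simp: S_def)
    then show ?thesis using l(2)[of w] by simp
  qed
  have "l w = 0" if "\<forall>d\<in>F. blinfun_apply w d = 0" for w
  proof -
    have "q (w - 0) = 0" "q (- w - 0) = 0" using that by (auto simp: q_def blinfun.minus_left)
    then have "l w \<le> 0" "l (- w) \<le> 0" using l_le[OF convex_cone_contains_0[OF K]] by metis+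
    then show ?thesis by (simp add: linear_neg[OF l(1)])
  qed
  moreover have "linear (\<lambda>w :: 'a \<Rightarrow>\<^sub>L real. blinfun_apply w d)" for d
    by (rule linearI) (simp_all add: blinfun.add_left blinfun.scaleR_left)
  ultimately obtain c where c: "\<And>w. l w = (\<Sum>d\<in>F. c d * blinfun_apply w d)"
    using functional_in_span_if_kernel_contains
      [OF F(1), of "\<lambda>d w. blinfun_apply w d" l] l(1) by blast
  then have eval: "l w = blinfun_apply w (\<Sum>d\<in>F. c d *\<^sub>R d)" for w
    by (simp add: blinfun.sum_right blinfun.scaleR_right)
  have "blinfun_apply k (\<Sum>d\<in>F. c d *\<^sub>R d) \<le> 0" if "k \<in> K" for k
    using l_le[OF that, of k] by (simp add: eval[symmetric] q_def)
  from polar[OF this] have "l v \<le> 0" by (simp add: eval)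
  moreover have "e \<le> Inf (S v)"
  proof (rule cInf_greatest)
    show "S v \<noteq> {}" using convex_cone_nonempty[OF K] by (auto simp: S_def)
    fix s assume "s \<in> S v"
    then obtain k where k: "k \<in> K" "s = q (v - k)" by (auto simp: S_def)
    then obtain d where d: "d \<in> F" "e \<le> \<bar>blinfun_apply k d - blinfun_apply v d\<bar>"
      using U(3) F(3) by (meson linorder_not_le)
    have "\<bar>blinfun_apply (v - k) d\<bar> \<le> q (v - k)"
      unfolding q_def by (rule member_le_sum[OF d(1)]) (auto simp: F(1))
    then show "e \<le> s" using d(2) k(2) by (simp add: blinfun.diff_left abs_minus_commute)
  qed
  ultimately show False using l(3) F(2) by simp
qed


section \<open>Surjective operators and the tangent space of a level set\<close>

text \<open>
  An abstract Newton iteration. Each step halves the residual \<open>norm (h x)\<close> at a cost of at most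
  \<open>\<kappa>\<close> times the residual, so the total distance travelled is a geometric series bounded by
  \<open>2 \<kappa> norm (h x0)\<close>. Both the open mapping theorem and Lyusternik's theorem are instances.
\<close>

lemma halving_iteration_zero:
  fixes h :: "'a::banach \<Rightarrow> 'b::real_normed_vector"
  assumes \<kappa>: "\<kappa> \<ge> 0"
    and cont: "continuous_on (cball x0 (2 * \<kappa> * norm (h x0))) h"
    and step: "\<And>x. x \<in> cball x0 (2 * \<kappa> * norm (h x0)) \<Longrightarrow>
      \<exists>u. norm u \<le> \<kappa> * norm (h x) \<and>
        (x + u \<in> cball x0 (2 * \<kappa> * norm (h x0)) \<longrightarrow> norm (h (x + u)) \<le> norm (h x) / 2)"
  shows "\<exists>x\<in>cball x0 (2 * \<kappa> * norm (h x0)). h x = 0"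
proof -
  define B where "B = cball x0 (2 * \<kappa> * norm (h x0))"
  \<comment> \<open>The distance is charged against the decrease of the residual, which keeps the iterates in the ball.\<close>
  define P where "P n x \<longleftrightarrow> norm (x - x0) \<le> 2 * \<kappa> * (norm (h x0) - norm (h x)) \<and>
    norm (h x) \<le> norm (h x0) / 2 ^ n" for n x
  have P_B: "x \<in> B" if "P n x" for n x
  proof -
    have "0 \<le> \<kappa> * norm (h x)" using \<kappa> by simp
    then show ?thesis
      using that by (simp add: P_def B_def dist_norm norm_minus_commute algebra_simps)
  qed
  have "\<exists>X. \<forall>n. P n (X n) \<and> norm (X (Suc n) - X n) \<le> \<kappa> * norm (h (X n))"
  proof (rule dependent_nat_choice)
    show "\<exists>x. P 0 x" by (rule exI[of _ x0]) (simp add: P_def)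
    fix x n assume x: "P n x"
    then obtain u where u: "norm u \<le> \<kappa> * norm (h x)"
      "x + u \<in> B \<Longrightarrow> norm (h (x + u)) \<le> norm (h x) / 2"
      using step[of x] P_B[OF x] by (auto simp: B_def)
    have dist: "norm (x + u - x0) \<le> 2 * \<kappa> * (norm (h x0) - norm (h x)) + \<kappa> * norm (h x)"
      using norm_triangle_ineq[of "x - x0" u] x u(1) by (simp add: P_def algebra_simps)
    moreover have "0 \<le> \<kappa> * norm (h x)" using \<kappa> by simp
    ultimately have "x + u \<in> B" by (simp add: B_def dist_norm norm_minus_commute algebra_simps)
    then have half: "norm (h (x + u)) \<le> norm (h x) / 2" by (rule u(2))
    from mult_left_mono[OF half \<kappa>]
    have "norm (x + u - x0) \<le> 2 * \<kappa> * (norm (h x0) - norm (h (x + u)))"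
      using dist by (simp add: algebra_simps)
    moreover have "norm (h (x + u)) \<le> norm (h x0) / 2 ^ Suc n"
      using half x by (simp add: P_def)
    ultimately show "\<exists>y. P (Suc n) y \<and> norm (y - x) \<le> \<kappa> * norm (h x)"
      using u(1) by (intro exI[of _ "x + u"]) (simp add: P_def)
  qed
  then obtain X where X: "\<And>n. P n (X n)"
    "\<And>n. norm (X (Suc n) - X n) \<le> \<kappa> * norm (h (X n))" by blast
  have hX: "norm (h (X n)) \<le> norm (h x0) * (1/2) ^ n" for n
    using X(1)[of n] by (simp add: P_def power_divide)
  have "summable (\<lambda>n. X (Suc n) - X n)"
  proof (rule summable_comparison_test')
    show "summable (\<lambda>n. \<kappa> * norm (h x0) * (1/2) ^ n)"
      by (intro summable_mult summable_geometric) simp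
    show "norm (X (Suc n) - X n) \<le> \<kappa> * norm (h x0) * (1/2) ^ n" for n
      using X(2)[of n] mult_left_mono[OF hX \<kappa>, of n] by (simp add: mult.assoc)
  qed
  then have "convergent (\<lambda>n. (\<Sum>i<n. X (Suc i) - X i))"
    using summable_LIMSEQ convergentI by blast
  then have "convergent (\<lambda>n. X n - X 0)" by (simp add: sum_lessThan_telescope)
  then have "convergent X"
    using convergent_diff_const_right_iff[of X "X 0"] by simp
  then obtain x where x: "X \<longlonglongrightarrow> x" by (auto simp: convergent_def)
  have XB: "X n \<in> B" for n using P_B X(1) by blast
  then have xB: "x \<in> B"
    using closed_sequentially[OF _ _ x, of B] by (auto simp: B_def)
  have "(\<lambda>n. h (X n)) \<longlonglongrightarrow> h x"
    using continuous_on_tendsto_compose[OF cont x] xB XB by (auto simp: B_def)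
  moreover have "(\<lambda>n. h (X n)) \<longlonglongrightarrow> 0"
  proof (rule Lim_null_comparison)
    show "\<forall>\<^sub>F n in sequentially. norm (h (X n)) \<le> norm (h x0) * (1/2) ^ n"
      using hX by simp
    show "(\<lambda>n. norm (h x0) * (1/2) ^ n) \<longlonglongrightarrow> 0"
      by (intro tendsto_mult_right_zero LIMSEQ_power_zero) simp
  qed
  ultimately have "h x = 0" by (rule LIMSEQ_unique)
  then show ?thesis using xB by (auto simp: B_def)
qed

text \<open>
  The Baire part of the open mapping theorem: the closed images of the balls \<open>cball 0 n\<close> cover the
  space, so one of them contains a ball; differences of two points of that ball recenter it at the
  origin.
\<close>

lemma surjective_almost_open:
  fixes A :: "'a::real_normed_vector \<Rightarrow>\<^sub>L 'b::banach"
  assumes "surj (blinfun_apply A)"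
  obtains \<kappa> where "\<kappa> > 0" "\<And>y. \<exists>u. norm u \<le> \<kappa> * norm y \<and> norm (y - blinfun_apply A u) \<le> norm y / 2"
proof -
  define S where "S n = closure (blinfun_apply A ` cball 0 (real n))" for n
  have "(\<Union>n. S n) = UNIV"
  proof safe
    fix y
    obtain u where u: "blinfun_apply A u = y" using assms by (metis surjD)
    obtain n where "norm u \<le> real n" using real_arch_simple by blast
    then have "y \<in> S n"
      unfolding S_def using u by (intro subsetD[OF closure_subset]) auto
    then show "y \<in> (\<Union>n. S n)" by blast
  qed simp
  have "\<exists>n. interior (S n) \<noteq> {}"
  proof (rule ccontr)
    assume "\<nexists>n. interior (S n) \<noteq> {}"
    then have "(euclidean :: 'b topology) interior_of \<Union>(range S) = {}"
      by (intro Baire_category_alt disjI1 completely_metrizable_space_euclidean)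
         (auto simp: S_def)
    then show False using \<open>(\<Union>n. S n) = UNIV\<close> by simp
  qed
  then obtain n y0 where "y0 \<in> interior (S n)" by blast
  then obtain r where r: "r > 0" "ball y0 r \<subseteq> S n"
    by (meson mem_interior)
  have approx: "\<exists>u. norm u \<le> 2 * real n \<and> norm (y - blinfun_apply A u) \<le> r / 4"
    if y: "norm y < r" for y
  proof -
    have near: "\<exists>u. norm u \<le> real n \<and> norm (w - blinfun_apply A u) < r / 8" if w: "w \<in> S n" for w
    proof -
      obtain a where "a \<in> blinfun_apply A ` cball 0 (real n)" "dist a w < r / 8"
        using w r(1) unfolding S_def closure_approachable by (meson divide_pos_pos zero_less_numeral)
      then show ?thesis by (auto simp: dist_norm norm_minus_commute)
    qed
    have "y0 + y \<in> S n" "y0 \<in> S n" using r y by (auto simp: dist_norm)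
    then obtain u1 u2 where u: "norm u1 \<le> real n" "norm (y0 + y - blinfun_apply A u1) < r / 8"
      "norm u2 \<le> real n" "norm (y0 - blinfun_apply A u2) < r / 8" using near by meson
    have eq: "y - blinfun_apply A (u1 - u2) = (y0 + y - blinfun_apply A u1) - (y0 - blinfun_apply A u2)"
      by (simp add: blinfun.diff_right)
    have "norm (y - blinfun_apply A (u1 - u2)) \<le> r / 4"
      unfolding eq using norm_triangle_ineq4[of "y0 + y - blinfun_apply A u1" "y0 - blinfun_apply A u2"] u(2,4)
      by linarith
    moreover have "norm (u1 - u2) \<le> 2 * real n" using norm_triangle_ineq4[of u1 u2] u by simp
    ultimately show ?thesis by blast
  qed
  show ?thesis
  proof (rule that[of "4 * real n / r + 1"])
    show "4 * real n / r + 1 > 0" using r(1) by (simp add: add_nonneg_pos)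
    fix y
    show "\<exists>u. norm u \<le> (4 * real n / r + 1) * norm y \<and> norm (y - blinfun_apply A u) \<le> norm y / 2"
    proof (cases "y = 0")
      case True
      then show ?thesis by (intro exI[of _ 0]) (simp add: blinfun.zero_right)
    next
      case False
      define c where "c = 2 * norm y / r"
      have c: "c > 0" using False r(1) by (simp add: c_def)
      have "norm ((1 / c) *\<^sub>R y) < r" using c r(1) False by (simp add: c_def)
      from approx[OF this] obtain u
        where u: "norm u \<le> 2 * real n" "norm ((1 / c) *\<^sub>R y - blinfun_apply A u) \<le> r / 4" by blast
      have "norm (c *\<^sub>R u) \<le> (4 * real n / r + 1) * norm y"
      proof -
        have "norm (c *\<^sub>R u) \<le> c * (2 * real n)" using c u(1) by simp
        also have "\<dots> \<le> (4 * real n / r + 1) * norm y" by (simp add: c_def algebra_simps)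
        finally show ?thesis .
      qed
      moreover have "norm (y - blinfun_apply A (c *\<^sub>R u)) \<le> norm y / 2"
      proof -
        have "y - blinfun_apply A (c *\<^sub>R u) = c *\<^sub>R ((1 / c) *\<^sub>R y - blinfun_apply A u)"
          using c by (simp add: scaleR_diff_right blinfun.scaleR_right)
        then have "norm (y - blinfun_apply A (c *\<^sub>R u)) = c * norm ((1 / c) *\<^sub>R y - blinfun_apply A u)"
          using c by simp
        also have "\<dots> \<le> c * (r / 4)" using c u(2) by simp
        also have "\<dots> = norm y / 2" using r(1) by (simp add: c_def)
        finally show ?thesis .
      qed
      ultimately show ?thesis by blast
    qed
  qed
qed

text \<open>
  The open mapping theorem as a norm bound on preimages. Approximate preimages become exact by
  iterating on the residual \<open>y - A x\<close>.
\<close>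

theorem bounded_right_inverse_of_surjective:
  fixes A :: "'a::banach \<Rightarrow>\<^sub>L 'b::banach"
  assumes "surj (blinfun_apply A)"
  obtains \<kappa> where "\<kappa> > 0" "\<And>y. \<exists>u. blinfun_apply A u = y \<and> norm u \<le> \<kappa> * norm y"
proof -
  obtain \<kappa> where \<kappa>: "\<kappa> > 0"
    "\<And>y. \<exists>u. norm u \<le> \<kappa> * norm y \<and> norm (y - blinfun_apply A u) \<le> norm y / 2"
    using surjective_almost_open[OF assms] by metis
  show ?thesis
  proof (rule that[of "2 * \<kappa>"])
    show "2 * \<kappa> > 0" using \<kappa>(1) by simp
    fix y
    have "\<exists>x\<in>cball 0 (2 * \<kappa> * norm (y - blinfun_apply A 0)). y - blinfun_apply A x = 0"
    proof (rule halving_iteration_zero)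
      fix x
      show "\<exists>u. norm u \<le> \<kappa> * norm (y - blinfun_apply A x) \<and>
          (x + u \<in> cball 0 (2 * \<kappa> * norm (y - blinfun_apply A 0)) \<longrightarrow>
            norm (y - blinfun_apply A (x + u)) \<le> norm (y - blinfun_apply A x) / 2)"
        using \<kappa>(2)[of "y - blinfun_apply A x"] by (auto simp: blinfun.add_right algebra_simps)
    qed (use \<kappa>(1) in \<open>auto intro!: continuous_intros\<close>)
    then show "\<exists>u. blinfun_apply A u = y \<and> norm u \<le> 2 * \<kappa> * norm y"
      by (auto simp: blinfun.zero_right)
  qed
qed

lemma has_strict_derivative_estimate:
  assumes "has_strict_derivative h D x" "e > 0"
  obtains \<delta> where "\<delta> > 0" "\<And>u v. u \<in> ball x \<delta> \<Longrightarrow> v \<in> ball x \<delta> \<Longrightarrow>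
    norm (h u - h v - blinfun_apply D (u - v)) \<le> e * norm (u - v)"
proof -
  obtain \<delta> where \<delta>: "\<delta> > 0" and est: "\<And>u v. u \<noteq> v \<Longrightarrow> (u, v) \<noteq> (x, x) \<Longrightarrow> dist (u, v) (x, x) < \<delta> \<Longrightarrow>
    norm ((h u - h v - blinfun_apply D (u - v)) /\<^sub>R norm (u - v)) < e"
    using tendstoD[OF assms(1)[unfolded has_strict_derivative_def] assms(2)]
    unfolding eventually_at by auto
  show ?thesis
  proof (rule that[of "\<delta> / 2"])
    show "\<delta> / 2 > 0" using \<delta> by simp
    fix u v assume uv: "u \<in> ball x (\<delta> / 2)" "v \<in> ball x (\<delta> / 2)"
    show "norm (h u - h v - blinfun_apply D (u - v)) \<le> e * norm (u - v)"
    proof (cases "u = v")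
      case False
      have "dist (u, v) (x, x) \<le> dist u x + dist v x"
        by (simp add: dist_Pair_Pair sqrt_sum_squares_le_sum)
      then have "dist (u, v) (x, x) < \<delta>" using uv by (simp add: dist_commute)
      from est[OF False _ this] False
      have "norm (h u - h v - blinfun_apply D (u - v)) / norm (u - v) < e"
        by (auto simp: divide_inverse mult.commute)
      then show ?thesis using False by (simp add: field_simps)
    qed (simp add: blinfun.zero_right)
  qed
qed

text \<open>
  A direction in the kernel of a surjective strict derivative is tangent to the level set. The
  residual of \<open>h\<close> at \<open>x + \<tau> d\<close> is at most \<open>e \<tau> norm d\<close>, with \<open>e\<close> the error of the strict
  derivative, and the Newton iteration with the operator \<open>D\<close> held fixed removes it within a
  distance proportional to it.
\<close>

theorem Lyusternik_tangent:
  fixes h :: "'a::banach \<Rightarrow> 'b::banach"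
  assumes strict: "has_strict_derivative h D x" and surj: "surj (blinfun_apply D)"
    and hx: "h x = 0" and d: "blinfun_apply D d = 0" and \<gamma>: "\<gamma> > 0"
  shows "\<forall>\<^sub>F \<tau> in at_right 0. \<exists>z. h z = 0 \<and> norm (z - (x + \<tau> *\<^sub>R d)) \<le> \<gamma> * \<tau>"
proof -
  obtain \<kappa> where \<kappa>: "\<kappa> > 0" "\<And>y. \<exists>u. blinfun_apply D u = y \<and> norm u \<le> \<kappa> * norm y"
    using bounded_right_inverse_of_surjective[OF surj] by metis
  \<comment> \<open>The first bound makes each Newton step halve the residual, the second makes the correction
    at most \<open>\<gamma> * \<tau>\<close>.\<close>
  define e where "e = min (1 / (2 * \<kappa>)) (\<gamma> / (2 * \<kappa> * (norm d + 1)))"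
  have nd: "norm d + 1 > 0" by (simp add: add_nonneg_pos)
  have e: "e > 0" "e * \<kappa> \<le> 1/2"
  proof -
    show "e > 0" using \<kappa>(1) \<gamma> nd by (simp add: e_def)
    have "e \<le> 1 / (2 * \<kappa>)" by (simp add: e_def)
    then show "e * \<kappa> \<le> 1/2" using \<kappa>(1) by (simp add: field_simps)
  qed
  have e2: "2 * \<kappa> * (e * norm d) \<le> \<gamma>"
  proof -
    have "e \<le> \<gamma> / (2 * \<kappa> * (norm d + 1))" by (simp add: e_def)
    then have "e * (2 * \<kappa> * (norm d + 1)) \<le> \<gamma>"
      using \<kappa>(1) nd by (subst (asm) pos_le_divide_eq) auto
    then have "2 * \<kappa> * (e * (norm d + 1)) \<le> \<gamma>" by (simp add: mult_ac)
    moreover have "2 * \<kappa> * (e * norm d) \<le> 2 * \<kappa> * (e * (norm d + 1))"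
      using \<kappa>(1) e by simp
    ultimately show ?thesis by simp
  qed
  obtain \<delta> where \<delta>: "\<delta> > 0" "\<And>u v. u \<in> ball x \<delta> \<Longrightarrow> v \<in> ball x \<delta> \<Longrightarrow>
    norm (h u - h v - blinfun_apply D (u - v)) \<le> e * norm (u - v)"
    using has_strict_derivative_estimate[OF strict e(1)] by metis
  have "(norm d + \<gamma>) > 0" using \<gamma> by (simp add: add_nonneg_pos)
  have "\<exists>z. h z = 0 \<and> norm (z - (x + \<tau> *\<^sub>R d)) \<le> \<gamma> * \<tau>"
    if \<tau>: "0 < \<tau>" "\<tau> < \<delta> / (norm d + \<gamma>)" for \<tau>
  proof -
    define x0 where "x0 = x + \<tau> *\<^sub>R d"
    define R where "R = 2 * \<kappa> * norm (h x0)"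
    have small: "\<tau> * norm d + \<gamma> * \<tau> < \<delta>"
      using \<tau>(2) \<open>norm d + \<gamma> > 0\<close> by (simp add: field_simps)
    moreover have "0 < \<gamma> * \<tau>" using \<gamma> \<tau>(1) by simp
    ultimately have "\<tau> * norm d < \<delta>" by linarith
    then have x0: "x0 \<in> ball x \<delta>" using \<tau>(1) by (simp add: x0_def dist_norm)
    have "norm (h x0) \<le> e * (\<tau> * norm d)"
      using \<delta>(2)[OF x0, of x] \<delta>(1) \<tau>(1) by (simp add: hx x0_def blinfun.scaleR_right d)
    then have "R \<le> 2 * \<kappa> * (e * (\<tau> * norm d))" using \<kappa>(1) by (simp add: R_def)
    also have "\<dots> \<le> \<gamma> * \<tau>" using mult_right_mono[OF e2, of \<tau>] \<tau>(1) by (simp add: mult_ac)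
    finally have R: "R \<le> \<gamma> * \<tau>" .
    have sub: "z \<in> ball x \<delta>" if "z \<in> cball x0 R" for z
    proof -
      have "norm (x - z) \<le> norm (x - x0) + norm (x0 - z)"
        using norm_triangle_ineq[of "x - x0" "x0 - z"] by simp
      also have "\<dots> \<le> \<tau> * norm d + \<gamma> * \<tau>"
        using that R \<tau>(1) by (simp add: x0_def dist_norm)
      finally show ?thesis using small by (simp add: dist_norm)
    qed
    have "\<exists>z\<in>cball x0 (2 * \<kappa> * norm (h x0)). h z = 0"
    proof (rule halving_iteration_zero, unfold R_def[symmetric])
      show "\<kappa> \<ge> 0" using \<kappa>(1) by simp
      have "(e + norm D)-lipschitz_on (cball x0 R) h"
      proof (rule lipschitz_onI)
        fix u v assume uv: "u \<in> cball x0 R" "v \<in> cball x0 R"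
        have "norm (h u - h v) \<le>
            norm (h u - h v - blinfun_apply D (u - v)) + norm (blinfun_apply D (u - v))"
          using norm_triangle_ineq[of "h u - h v - blinfun_apply D (u - v)" "blinfun_apply D (u - v)"]
          by simp
        also have "\<dots> \<le> e * norm (u - v) + norm D * norm (u - v)"
          by (intro add_mono \<delta>(2) sub uv norm_blinfun)
        finally show "dist (h u) (h v) \<le> (e + norm D) * dist u v"
          by (simp add: dist_norm distrib_right)
      qed (use e(1) in simp)
      then show "continuous_on (cball x0 R) h" by (rule lipschitz_on_continuous_on)
      fix z assume z: "z \<in> cball x0 R"
      obtain u where u: "blinfun_apply D u = - h z" "norm u \<le> \<kappa> * norm (h z)"
        using \<kappa>(2)[of "- h z"] by auto
      have "norm (h (z + u)) \<le> norm (h z) / 2" if "z + u \<in> cball x0 R"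
      proof -
        have "norm (h (z + u)) \<le> e * norm u"
          using \<delta>(2)[OF sub[OF that] sub[OF z]] u(1) by simp
        also have "\<dots> \<le> e * (\<kappa> * norm (h z))" using u(2) e(1) by simp
        also have "\<dots> \<le> 1/2 * norm (h z)"
          using mult_right_mono[OF e(2), of "norm (h z)"] by (simp add: mult_ac)
        finally show ?thesis by simp
      qed
      then show "\<exists>u. norm u \<le> \<kappa> * norm (h z) \<and>
          (z + u \<in> cball x0 R \<longrightarrow> norm (h (z + u)) \<le> norm (h z) / 2)"
        using u(2) by blast
    qed
    then obtain z where "z \<in> cball x0 R" "h z = 0" by (auto simp: R_def)
    then show ?thesis using R by (intro exI[of _ z]) (auto simp: x0_def dist_norm norm_minus_commute)
  qed
  moreover have "\<delta> / (norm d + \<gamma>) > 0" using \<delta>(1) \<open>norm d + \<gamma> > 0\<close> by simp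
  ultimately show ?thesis
    unfolding eventually_at_right_field by (intro exI[of _ "\<delta> / (norm d + \<gamma>)"]) simp
qed


section \<open>Primal conditions at a local minimizer\<close>

lemma nonneg_if_add_small_nonneg:
  fixes a b :: real
  assumes "s0 > 0" "\<And>s. 0 < s \<Longrightarrow> s < s0 \<Longrightarrow> a + s * b \<ge> 0"
  shows "a \<ge> 0"
proof (rule tendsto_lowerbound)
  have "((\<lambda>s. a + s * b) \<longlongrightarrow> a + 0 * b) (at_right 0)" by (intro tendsto_intros)
  then show "((\<lambda>s. a + s * b) \<longlongrightarrow> a) (at_right 0)" by simp
  show "\<forall>\<^sub>F s in at_right 0. 0 \<le> a + s * b"
    using assms unfolding eventually_at_right_field by blast
qed simp

text \<open>
  Uniformity in \<open>t\<close> is what allows infinitely many constraints to be treated at once. An infinite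
  value of \<open>g t z\<close> would make the quotient in the modulus infinite, so the estimate includes
  finiteness from above.
\<close>

lemma uniformly_frechet_differentiable_upper_estimate:
  assumes uni: "uniformly_frechet_differentiable T g Dg x"
    and fin: "\<And>t. t \<in> T \<Longrightarrow> \<bar>g t x\<bar> \<noteq> \<infinity>" and e: "e > 0"
  obtains \<eta> where "\<eta> > 0" "\<And>t z. t \<in> T \<Longrightarrow> norm (z - x) < \<eta> \<Longrightarrow>
    g t z \<le> ereal (real_of_ereal (g t x) + blinfun_apply (Dg t) (z - x) + e * norm (z - x))"
proof -
  have "\<forall>\<^sub>F \<eta> in at_right 0. frechet_modulus T g Dg x \<eta> < ereal e"
    using order_tendstoD(2)[OF uni[unfolded uniformly_frechet_differentiable_def], of "ereal e"] e
    by simp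
  then obtain b where b: "b > 0" "\<And>y. 0 < y \<Longrightarrow> y < b \<Longrightarrow> frechet_modulus T g Dg x y < ereal e"
    unfolding eventually_at_right_field by blast
  show ?thesis
  proof (rule that[of "b / 2"])
    show "b / 2 > 0" using b(1) by simp
    fix t z assume t: "t \<in> T" and z: "norm (z - x) < b / 2"
    obtain s where s: "g t x = ereal s" using fin[OF t] by (cases "g t x") auto
    show "g t z \<le> ereal (real_of_ereal (g t x) + blinfun_apply (Dg t) (z - x) + e * norm (z - x))"
    proof (cases "z = x")
      case True
      then show ?thesis by (simp add: s blinfun.zero_right)
    next
      case False
      let ?q = "\<lambda>t z. \<bar>g t z - g t x - ereal (blinfun_apply (Dg t) (z - x))\<bar> / ereal (norm (z - x))"
      have "z \<in> cball x (b / 2) - {x}" using z False by (simp add: dist_norm norm_minus_commute)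
      then have "?q t z \<le> (SUP z\<in>cball x (b / 2) - {x}. ?q t z)" by (rule SUP_upper)
      also have "\<dots> \<le> (SUP t\<in>T. SUP z\<in>cball x (b / 2) - {x}. ?q t z)"
        using t by (rule SUP_upper)
      also have "\<dots> \<le> frechet_modulus T g Dg x (b / 2)" by (simp add: frechet_modulus_def)
      also have "\<dots> < ereal e" using b by simp
      finally have q: "?q t z < ereal e" .
      have n: "norm (z - x) > 0" using False by simp
      show ?thesis
      proof (cases "g t z")
        case (real r)
        then have "\<bar>r - s - blinfun_apply (Dg t) (z - x)\<bar> / norm (z - x) < e" using q s n by simp
        then have "\<bar>r - s - blinfun_apply (Dg t) (z - x)\<bar> < e * norm (z - x)"
          using n by (simp add: pos_divide_less_eq)
        then show ?thesis by (simp add: real s)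
      next
        case PInf
        then show ?thesis using q s n by simp
      qed simp
    qed
  qed
qed

text \<open>
  The qualification condition in the form in which it is used: one tolerance and one margin that
  serve all almost active constraints.
\<close>

lemma PMFCQ_slater_direction:
  assumes "PMFCQ T g Dg Dh x"
  obtains d \<epsilon> c where "blinfun_apply Dh d = 0" "\<epsilon> > 0" "c > 0"
    "\<And>t. t \<in> eps_active_set T g x \<epsilon> \<Longrightarrow> blinfun_apply (Dg t) d \<le> - c"
proof -
  obtain d where d: "blinfun_apply Dh d = 0"
    "(INF \<epsilon>\<in>{0<..}. SUP t\<in>eps_active_set T g x \<epsilon>. ereal (blinfun_apply (Dg t) d)) < 0"
    using assms by (auto simp: PMFCQ_def)
  then obtain \<epsilon> where \<epsilon>: "\<epsilon> > 0" "(SUP t\<in>eps_active_set T g x \<epsilon>. ereal (blinfun_apply (Dg t) d)) < 0"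
    by (auto simp: INF_less_iff)
  then obtain b where b: "(SUP t\<in>eps_active_set T g x \<epsilon>. ereal (blinfun_apply (Dg t) d)) < ereal b" "ereal b < 0"
    using ereal_dense2 by blast
  show ?thesis
  proof (rule that[OF d(1) \<epsilon>(1), of "- b"])
    show "- b > 0" using b(2) by simp
    fix t assume "t \<in> eps_active_set T g x \<epsilon>"
    then have "ereal (blinfun_apply (Dg t) d) < ereal b"
      using b(1) by (meson SUP_upper order_le_less_trans)
    then show "blinfun_apply (Dg t) d \<le> - (- b)" by simp
  qed
qed

text \<open>
  A direction \<open>d\<close> in the kernel of \<open>Dh\<close> along which all almost active constraints decrease at a
  uniform rate \<open>a\<close> can be followed by feasible points \<open>z = x + \<tau> d + o(\<tau>)\<close> with \<open>h z = 0\<close>.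
  The rate \<open>a\<close> absorbs the uniform first-order error in the \<open>\<epsilon>\<close>-active constraints. The others
  start below \<open>- \<epsilon>\<close> and, their derivatives being bounded, cannot reach \<open>0\<close> within a short
  distance.
\<close>

lemma derivative_nonneg_on_strict_directions:
  fixes f :: "'a::banach \<Rightarrow> ereal" and h :: "'a \<Rightarrow> 'b::banach"
  assumes min: "local_minimizer_on f (feasible_set T g h) x"
    and sa: "standing_assumptions T g Dg h Dh x"
    and uni: "uniformly_frechet_differentiable T g Dg x"
    and f: "ereal_has_frechet_derivative f Df x"
    and surj: "surj (blinfun_apply Dh)"
    and d: "blinfun_apply Dh d = 0" and a: "a > 0" and \<epsilon>: "\<epsilon> > 0"
    and neg: "\<And>t. t \<in> eps_active_set T g x \<epsilon> \<Longrightarrow> blinfun_apply (Dg t) d \<le> - a"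
  shows "blinfun_apply Df d \<ge> 0"
proof -
  have strict: "has_strict_derivative h Dh x" using sa by (simp add: standing_assumptions_def)
  obtain U where U: "open U" "x \<in> U" "\<And>z. z \<in> feasible_set T g h \<Longrightarrow> z \<in> U \<Longrightarrow> f x \<le> f z"
    and feas: "x \<in> feasible_set T g h"
    using min by (auto simp: local_minimizer_on_def)
  have hx: "h x = 0" and gx: "\<And>t. t \<in> T \<Longrightarrow> g t x \<le> 0" using feas by (auto simp: feasible_set_def)
  have fin: "\<bar>g t x\<bar> \<noteq> \<infinity>" if "t \<in> T" for t
    using sa that eventually_nhds_x_imp_x
    by (fastforce simp: standing_assumptions_def ereal_has_frechet_derivative_def)
  obtain M where M: "M > 0" "\<And>t. t \<in> T \<Longrightarrow> norm (Dg t) \<le> M"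
    using sa by (auto simp: standing_assumptions_def bounded_pos)
  have ffin: "\<forall>\<^sub>F z in nhds x. \<bar>f z\<bar> \<noteq> \<infinity>"
    and fder: "((\<lambda>z. real_of_ereal (f z)) has_derivative blinfun_apply Df) (at x)"
    using f by (auto simp: ereal_has_frechet_derivative_def)
  define N where "N = M + norm d + 1"
  have N: "N > 0" using M(1) by (simp add: N_def add_pos_nonneg)
  show ?thesis
  \<comment> \<open>With relative error \<open>\<gamma>\<close> everywhere, the conclusion holds up to a multiple of \<open>\<gamma>\<close>.
    The bound \<open>a / N\<close> on \<open>\<gamma>\<close> is where the rate \<open>a\<close> still dominates all errors.\<close>
  proof (rule nonneg_if_add_small_nonneg[of "min 1 (a / N)" _ "norm Df + norm d + 1"])
    show "min 1 (a / N) > 0" using a N by simp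
    fix \<gamma> :: real assume \<gamma>: "0 < \<gamma>" "\<gamma> < min 1 (a / N)"
    then have \<gamma>1: "\<gamma> < 1" and \<gamma>N: "\<gamma> * N \<le> a" using N by (auto simp: field_simps)
    obtain \<eta>1 where \<eta>1: "\<eta>1 > 0" "\<And>t z. t \<in> T \<Longrightarrow> norm (z - x) < \<eta>1 \<Longrightarrow>
      g t z \<le> ereal (real_of_ereal (g t x) + blinfun_apply (Dg t) (z - x) + \<gamma> * norm (z - x))"
      using uniformly_frechet_differentiable_upper_estimate[OF uni fin \<gamma>(1)] by metis
    obtain \<eta>2 where \<eta>2: "\<eta>2 > 0" "\<And>z. norm (z - x) < \<eta>2 \<Longrightarrow>
      norm (real_of_ereal (f z) - real_of_ereal (f x) - blinfun_apply Df (z - x)) \<le> \<gamma> * norm (z - x)"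
      using fder \<gamma>(1) unfolding has_derivative_at_alt by blast
    have "\<forall>\<^sub>F z in nhds x. \<bar>f z\<bar> \<noteq> \<infinity> \<and> z \<in> U"
      using ffin eventually_nhds_in_open[OF U(1,2)] by (rule eventually_conj)
    then obtain \<eta>3 where \<eta>3: "\<eta>3 > 0" "\<And>z. dist z x < \<eta>3 \<Longrightarrow> \<bar>f z\<bar> \<noteq> \<infinity> \<and> z \<in> U"
      unfolding eventually_nhds_metric by blast
    define \<eta> where "\<eta> = min (min \<eta>1 \<eta>2) (min \<eta>3 (\<epsilon> / (M + 1)))"
    have \<eta>: "\<eta> > 0" using \<eta>1(1) \<eta>2(1) \<eta>3(1) \<epsilon> M(1) by (simp add: \<eta>_def)
    have nd: "norm d + 1 > 0" by (simp add: add_nonneg_pos)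
    have "\<forall>\<^sub>F \<tau> in at_right 0. 0 < \<tau> \<and> \<tau> < \<eta> / (norm d + 1)"
      using \<eta> nd unfolding eventually_at_right_field by (intro exI[of _ "\<eta> / (norm d + 1)"]) auto
    then have "\<forall>\<^sub>F \<tau> in at_right 0. (0 < \<tau> \<and> \<tau> < \<eta> / (norm d + 1)) \<and>
        (\<exists>z. h z = 0 \<and> norm (z - (x + \<tau> *\<^sub>R d)) \<le> \<gamma> * \<tau>)"
      using Lyusternik_tangent[OF strict surj hx d \<gamma>(1)] by (rule eventually_conj)
    then obtain \<tau> z where \<tau>: "0 < \<tau>" "\<tau> < \<eta> / (norm d + 1)" and hz: "h z = 0"
      and z: "norm (z - (x + \<tau> *\<^sub>R d)) \<le> \<gamma> * \<tau>"
      using eventually_happens'[OF trivial_limit_at_right_real] by blast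
    define w where "w = z - x"
    have w: "norm (w - \<tau> *\<^sub>R d) \<le> \<gamma> * \<tau>" using z by (simp add: w_def algebra_simps)
    have nw: "norm w \<le> \<tau> * (norm d + 1)"
    proof -
      have "norm w \<le> norm (w - \<tau> *\<^sub>R d) + \<tau> * norm d"
        using norm_triangle_ineq[of "w - \<tau> *\<^sub>R d" "\<tau> *\<^sub>R d"] \<tau>(1) by simp
      moreover have "\<gamma> * \<tau> \<le> \<tau>" using \<tau>(1) \<gamma>1 by simp
      ultimately have "norm w \<le> \<tau> * norm d + \<tau>" using w by linarith
      then show ?thesis by (simp add: distrib_left)
    qed
    also have "\<dots> < \<eta>" using \<tau>(2) nd by (simp add: field_simps)
    finally have w\<eta>: "norm w < \<eta>" .
    have apply_w: "blinfun_apply L w \<le> \<tau> * blinfun_apply L d + norm L * (\<gamma> * \<tau>)" for L :: "'a \<Rightarrow>\<^sub>L real"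
    proof -
      have "blinfun_apply L w = \<tau> * blinfun_apply L d + blinfun_apply L (w - \<tau> *\<^sub>R d)"
        by (simp add: blinfun.diff_right blinfun.scaleR_right)
      moreover have "blinfun_apply L (w - \<tau> *\<^sub>R d) \<le> norm L * norm (w - \<tau> *\<^sub>R d)"
        using norm_blinfun[of L "w - \<tau> *\<^sub>R d"] by simp
      moreover have "\<dots> \<le> norm L * (\<gamma> * \<tau>)" using w by (intro mult_left_mono) auto
      ultimately show ?thesis by linarith
    qed
    have \<gamma>w: "\<gamma> * norm w \<le> \<gamma> * (\<tau> * (norm d + 1))" using nw \<gamma>(1) by simp
    have "g t z \<le> 0" if t: "t \<in> T" for t
    proof -
      obtain s where s: "g t x = ereal s" using fin[OF t] by (cases "g t x") auto
      have s0: "s \<le> 0" using gx[OF t] s by simp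
      have "s + blinfun_apply (Dg t) w + \<gamma> * norm w \<le> 0"
      proof (cases "t \<in> eps_active_set T g x \<epsilon>")
        case True
        have "\<tau> * blinfun_apply (Dg t) d \<le> \<tau> * (- a)"
          using neg[OF True] \<tau>(1) by (intro mult_left_mono) auto
        moreover have "norm (Dg t) * (\<gamma> * \<tau>) \<le> M * (\<gamma> * \<tau>)"
          using M(2)[OF t] \<gamma>(1) \<tau>(1) by (intro mult_right_mono) auto
        moreover have "\<tau> * (\<gamma> * N) \<le> \<tau> * a" using \<gamma>N \<tau>(1) by simp
        ultimately show ?thesis
          using apply_w[of "Dg t"] \<gamma>w s0 by (simp add: N_def algebra_simps)
      next
        case False
        then have "s < - \<epsilon>" using t s by (auto simp: eps_active_set_def)
        moreover have "blinfun_apply (Dg t) w \<le> M * norm w"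
          using norm_blinfun[of "Dg t" w] mult_right_mono[OF M(2)[OF t] norm_ge_zero[of w]] by simp
        moreover have "\<gamma> * norm w \<le> norm w" using \<gamma>1 \<gamma>(1) mult_right_mono[of \<gamma> 1 "norm w"] by simp
        moreover have "(M + 1) * norm w < \<epsilon>"
          using w\<eta> M(1) by (simp add: \<eta>_def field_simps)
        ultimately show ?thesis by (simp add: algebra_simps)
      qed
      then have "ereal (s + blinfun_apply (Dg t) w + \<gamma> * norm w) \<le> 0" by simp
      moreover have "g t z \<le> ereal (s + blinfun_apply (Dg t) w + \<gamma> * norm w)"
        using \<eta>1(2)[OF t, of z] w\<eta> by (simp add: w_def \<eta>_def s)
      ultimately show ?thesis by (rule order_trans[rotated])
    qed
    then have "z \<in> feasible_set T g h" using hz by (simp add: feasible_set_def)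
    moreover have "\<bar>f z\<bar> \<noteq> \<infinity>" "z \<in> U" using \<eta>3(2)[of z] w\<eta> by (auto simp: dist_norm w_def \<eta>_def)
    moreover have "\<bar>f x\<bar> \<noteq> \<infinity>" using \<eta>3(2)[of x] \<eta>3(1) by simp
    ultimately have "real_of_ereal (f x) \<le> real_of_ereal (f z)"
      using U(3)[of z] by (cases "f x"; cases "f z") auto
    then have "0 \<le> blinfun_apply Df w + \<gamma> * norm w"
      using \<eta>2(2)[of z] w\<eta> by (simp add: w_def \<eta>_def abs_le_iff)
    then have "0 \<le> \<tau> * (blinfun_apply Df d + \<gamma> * (norm Df + norm d + 1))"
      using apply_w[of Df] \<gamma>w by (simp add: algebra_simps)
    then show "0 \<le> blinfun_apply Df d + \<gamma> * (norm Df + norm d + 1)"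
      using \<tau>(1) by (simp add: zero_le_mult_iff)
  qed
qed

text \<open>
  The directions whose negative polar is the intersection of the weak* closed cones generated by
  the \<open>\<epsilon>\<close>-active gradients. Keeping the union over all \<open>\<epsilon>\<close> as one primal cone is what
  yields a single multiplier valid for every \<open>\<epsilon>\<close>.
\<close>

definition eps_linearized_cone ::
    "'t set \<Rightarrow> ('t \<Rightarrow> 'a \<Rightarrow> ereal) \<Rightarrow> ('t \<Rightarrow> 'a::real_normed_vector \<Rightarrow>\<^sub>L real) \<Rightarrow>
     'a \<Rightarrow> 'a set"
  where "eps_linearized_cone T g Dg x =
    {d. \<exists>\<epsilon>>0. \<forall>t\<in>eps_active_set T g x \<epsilon>. blinfun_apply (Dg t) d \<le> 0}"

lemma eps_active_set_mono: "\<epsilon> \<le> \<epsilon>' \<Longrightarrow> eps_active_set T g x \<epsilon> \<subseteq> eps_active_set T g x \<epsilon>'"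
  unfolding eps_active_set_def by (auto intro: order_trans[of "ereal (- \<epsilon>')" "ereal (- \<epsilon>)"])

text \<open>
  Closed under addition because the defining conditions weaken as \<open>\<epsilon>\<close> decreases: two directions
  share the smaller of their two \<open>\<epsilon>\<close>.
\<close>

lemma convex_cone_eps_linearized_cone: "convex_cone (eps_linearized_cone T g Dg x)"
  unfolding convex_cone_iff
proof (intro conjI ballI allI impI)
  show "0 \<in> eps_linearized_cone T g Dg x"
    by (auto simp: eps_linearized_cone_def blinfun.zero_right intro: exI[of _ 1])
next
  fix d e assume "d \<in> eps_linearized_cone T g Dg x" "e \<in> eps_linearized_cone T g Dg x"
  then obtain \<epsilon> \<epsilon>' where "\<epsilon> > 0" "\<forall>t\<in>eps_active_set T g x \<epsilon>. blinfun_apply (Dg t) d \<le> 0"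
    "\<epsilon>' > 0" "\<forall>t\<in>eps_active_set T g x \<epsilon>'. blinfun_apply (Dg t) e \<le> 0"
    by (auto simp: eps_linearized_cone_def)
  then have "min \<epsilon> \<epsilon>' > 0" "\<forall>t\<in>eps_active_set T g x (min \<epsilon> \<epsilon>'). blinfun_apply (Dg t) (d + e) \<le> 0"
    using eps_active_set_mono[of "min \<epsilon> \<epsilon>'" \<epsilon> T g x] eps_active_set_mono[of "min \<epsilon> \<epsilon>'" \<epsilon>' T g x]
    by (auto simp: blinfun.add_right intro!: add_nonpos_nonpos)
  then show "d + e \<in> eps_linearized_cone T g Dg x" unfolding eps_linearized_cone_def by blast
next
  fix d and c :: real assume "d \<in> eps_linearized_cone T g Dg x" "c \<ge> 0"
  then show "c *\<^sub>R d \<in> eps_linearized_cone T g Dg x"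
    by (auto simp: eps_linearized_cone_def blinfun.scaleR_right mult_nonneg_nonpos)
qed

text \<open>
  Adding a small multiple of the Slater direction turns weak inequalities into uniformly strict
  ones; then the multiple tends to \<open>0\<close>.
\<close>

lemma derivative_nonneg_on_eps_linearized_cone:
  fixes f :: "'a::banach \<Rightarrow> ereal" and h :: "'a \<Rightarrow> 'b::banach"
  assumes min: "local_minimizer_on f (feasible_set T g h) x"
    and sa: "standing_assumptions T g Dg h Dh x"
    and cq: "PMFCQ T g Dg Dh x"
    and uni: "uniformly_frechet_differentiable T g Dg x"
    and f: "ereal_has_frechet_derivative f Df x"
    and d: "d \<in> eps_linearized_cone T g Dg x" "blinfun_apply Dh d = 0"
  shows "blinfun_apply Df d \<ge> 0"
proof -
  obtain d0 \<epsilon>0 c where d0: "blinfun_apply Dh d0 = 0" "\<epsilon>0 > 0" "c > 0"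
    "\<And>t. t \<in> eps_active_set T g x \<epsilon>0 \<Longrightarrow> blinfun_apply (Dg t) d0 \<le> - c"
    using PMFCQ_slater_direction[OF cq] by metis
  obtain \<epsilon> where \<epsilon>: "\<epsilon> > 0" "\<And>t. t \<in> eps_active_set T g x \<epsilon> \<Longrightarrow> blinfun_apply (Dg t) d \<le> 0"
    using d(1) by (auto simp: eps_linearized_cone_def)
  show ?thesis
  proof (rule nonneg_if_add_small_nonneg[of 1 _ "blinfun_apply Df d0"])
    fix s :: real assume s: "0 < s"
    have "0 \<le> blinfun_apply Df (d + s *\<^sub>R d0)"
    proof (rule derivative_nonneg_on_strict_directions[OF min sa uni f])
      show "surj (blinfun_apply Dh)" using cq by (simp add: PMFCQ_def)
      show "blinfun_apply Dh (d + s *\<^sub>R d0) = 0"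
        by (simp add: blinfun.add_right blinfun.scaleR_right d(2) d0(1))
      show "s * c > 0" "min \<epsilon> \<epsilon>0 > 0" using s d0 \<epsilon> by auto
      fix t assume "t \<in> eps_active_set T g x (min \<epsilon> \<epsilon>0)"
      then have "blinfun_apply (Dg t) d \<le> 0" "blinfun_apply (Dg t) d0 \<le> - c"
        using eps_active_set_mono[of "min \<epsilon> \<epsilon>0" \<epsilon> T g x]
          eps_active_set_mono[of "min \<epsilon> \<epsilon>0" \<epsilon>0 T g x] \<epsilon>(2) d0(4) by auto
      then show "blinfun_apply (Dg t) (d + s *\<^sub>R d0) \<le> - (s * c)"
        using mult_left_mono[of "blinfun_apply (Dg t) d0" "- c" s] s
        by (simp add: blinfun.add_right blinfun.scaleR_right)
    qed
    then show "0 \<le> blinfun_apply Df d + s * blinfun_apply Df d0"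
      by (simp add: blinfun.add_right blinfun.scaleR_right)
  qed simp
qed

section \<open>Multipliers\<close>

text \<open>
  Linear programming duality on the cone \<open>C\<close> of linearized directions. The Slater direction is an
  interior point of \<open>C\<close> in the kernel of \<open>Dh\<close>: preimages under \<open>Dh\<close> can be pushed into \<open>C\<close> at a
  cost proportional to their norm. Therefore \<open>Dh\<close> maps \<open>C\<close> onto the whole space, a multiplier \<open>z\<close>
  exists, and the same linear cost bound makes \<open>z\<close> continuous. The functional
  \<open>v = z \<circ> Dh - Df\<close> is nonpositive on \<open>C\<close>, and the bipolar theorem applies for each \<open>\<epsilon>\<close>.
\<close>

lemma asymptotic_multiplier_rule:
  fixes f :: "'a::banach \<Rightarrow> ereal" and h :: "'a \<Rightarrow> 'b::banach"
  assumes min: "local_minimizer_on f (feasible_set T g h) x"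
    and sa: "standing_assumptions T g Dg h Dh x"
    and cq: "PMFCQ T g Dg Dh x"
    and uni: "uniformly_frechet_differentiable T g Dg x"
    and f: "ereal_has_frechet_derivative f Df x"
  obtains v ystar where "0 = Df + v + dual_adjoint Dh ystar"
    "\<And>\<epsilon>. \<epsilon> > 0 \<Longrightarrow> v \<in> weak_star closure_of (convex_cone hull (Dg ` eps_active_set T g x \<epsilon>))"
proof -
  define C where "C = eps_linearized_cone T g Dg x"
  have surj: "surj (blinfun_apply Dh)" using cq by (simp add: PMFCQ_def)
  obtain d0 \<epsilon>0 c where d0: "blinfun_apply Dh d0 = 0" "\<epsilon>0 > 0" "c > 0"
    "\<And>t. t \<in> eps_active_set T g x \<epsilon>0 \<Longrightarrow> blinfun_apply (Dg t) d0 \<le> - c"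
    using PMFCQ_slater_direction[OF cq] by metis
  obtain M where M: "M > 0" "\<And>t. t \<in> T \<Longrightarrow> norm (Dg t) \<le> M"
    using sa by (auto simp: standing_assumptions_def bounded_pos)
  obtain \<kappa> where \<kappa>: "\<kappa> > 0" "\<And>y. \<exists>u. blinfun_apply Dh u = y \<and> norm u \<le> \<kappa> * norm y"
    using bounded_right_inverse_of_surjective[OF surj] by metis
  define L where "L = \<kappa> + M * \<kappa> / c * norm d0"
  have lift: "\<exists>d\<in>C. blinfun_apply Dh d = y \<and> norm d \<le> L * norm y" for y
  proof -
    obtain u where u: "blinfun_apply Dh u = y" "norm u \<le> \<kappa> * norm y" using \<kappa>(2) by blast
    define r where "r = M * \<kappa> / c * norm y"
    have r: "r \<ge> 0" using M(1) \<kappa>(1) d0(3) by (simp add: r_def)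
    have "blinfun_apply (Dg t) (u + r *\<^sub>R d0) \<le> 0" if t: "t \<in> eps_active_set T g x \<epsilon>0" for t
    proof -
      have "t \<in> T" using t by (simp add: eps_active_set_def)
      have "blinfun_apply (Dg t) u \<le> norm (Dg t) * norm u" using norm_blinfun[of "Dg t" u] by simp
      also have "\<dots> \<le> M * (\<kappa> * norm y)"
        using M u(2) \<open>t \<in> T\<close> by (intro mult_mono) auto
      finally have "blinfun_apply (Dg t) u \<le> M * (\<kappa> * norm y)" .
      moreover have "r * blinfun_apply (Dg t) d0 \<le> r * (- c)"
        using d0(4)[OF t] r by (rule mult_left_mono)
      moreover have "r * c = M * (\<kappa> * norm y)" using d0(3) by (simp add: r_def)
      ultimately show ?thesis by (simp add: blinfun.add_right blinfun.scaleR_right)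
    qed
    then have "u + r *\<^sub>R d0 \<in> C" using d0(2) by (auto simp: C_def eps_linearized_cone_def)
    moreover have "norm (u + r *\<^sub>R d0) \<le> L * norm y"
    proof -
      have "norm (u + r *\<^sub>R d0) \<le> norm u + r * norm d0"
        using norm_triangle_ineq[of u "r *\<^sub>R d0"] r by simp
      then show ?thesis using u(2) by (simp add: L_def r_def algebra_simps)
    qed
    ultimately show ?thesis
      using u(1) by (intro bexI[of _ "u + r *\<^sub>R d0"]) (auto simp: blinfun.add_right blinfun.scaleR_right d0(1))
  qed
  obtain z where z: "linear z" "\<And>d. d \<in> C \<Longrightarrow> z (blinfun_apply Dh d) \<le> blinfun_apply Df d"
  proof (rule linear_nonneg_on_kernel_extension[of C "blinfun_apply Dh" "blinfun_apply Df"])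
    show "convex_cone C" unfolding C_def by (rule convex_cone_eps_linearized_cone)
    show "linear (blinfun_apply Dh)" "linear (blinfun_apply Df)"
      by (simp_all add: blinfun.bounded_linear_right bounded_linear.linear)
    show "blinfun_apply Dh ` C = UNIV" using lift by (metis UNIV_eq_I imageI)
    show "0 \<le> blinfun_apply Df d" if "d \<in> C" "blinfun_apply Dh d = 0" for d
      using derivative_nonneg_on_eps_linearized_cone[OF min sa cq uni f] that by (simp add: C_def)
  qed blast
  have z_le: "z y \<le> norm Df * L * norm y" for y
  proof -
    obtain d where d: "d \<in> C" "blinfun_apply Dh d = y" "norm d \<le> L * norm y" using lift by blast
    have "z y \<le> blinfun_apply Df d" using z(2)[OF d(1)] d(2) by simp
    also have "\<dots> \<le> norm Df * norm d" using norm_blinfun[of Df d] by simp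
    also have "\<dots> \<le> norm Df * (L * norm y)" using d(3) by (intro mult_left_mono) auto
    finally show ?thesis by (simp add: mult.assoc)
  qed
  have "bounded_linear z"
  proof (rule bounded_linear_intro[of _ "norm Df * L"])
    show "norm (z y) \<le> norm y * (norm Df * L)" for y
      using z_le[of y] z_le[of "- y"] by (simp add: linear_neg[OF z(1)] mult_ac abs_le_iff)
  qed (simp_all add: linear_add[OF z(1)] linear_scale[OF z(1)])
  then have zB: "blinfun_apply (Blinfun z) = z" by (rule bounded_linear_Blinfun_apply)
  define v where "v = - Df + dual_adjoint Dh (Blinfun z)"
  show ?thesis
  proof (rule that[of v "- Blinfun z"])
    show "0 = Df + v + dual_adjoint Dh (- Blinfun z)"
      by (rule blinfun_eqI)
         (simp add: v_def dual_adjoint_def blinfun.add_left blinfun.minus_left)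
    fix \<epsilon> :: real assume \<epsilon>: "\<epsilon> > 0"
    show "v \<in> weak_star closure_of (convex_cone hull (Dg ` eps_active_set T g x \<epsilon>))"
    proof (rule weak_star_bipolar[OF convex_cone_convex_cone_hull])
      fix d assume "\<And>k. k \<in> convex_cone hull (Dg ` eps_active_set T g x \<epsilon>) \<Longrightarrow> blinfun_apply k d \<le> 0"
      then have "d \<in> C" using \<epsilon> by (auto simp: C_def eps_linearized_cone_def hull_inc)
      from z(2)[OF this] show "blinfun_apply v d \<le> 0"
        by (simp add: v_def dual_adjoint_def zB blinfun.diff_left)
    qed
  qed
qed

text \<open>
  A conic combination \<open>k = (\<Sum>t. l t Dg t)\<close> of \<open>\<epsilon>\<close>-active gradients lifts to the constraint cone
  with second component \<open>k x - (\<Sum>t. l t g t x)\<close>. The excess over \<open>k x\<close> is at most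
  \<open>\<epsilon> (\<Sum>t. l t)\<close>, and the Slater direction \<open>d\<close> bounds the sum of the weights by \<open>- k d / c\<close>.
  Stating the bound through \<open>k d\<close> keeps it linear in \<open>k\<close>, so that it passes through hull induction
  and to weak* limits.
\<close>

lemma constraint_cone_slack:
  assumes gx: "\<And>t. t \<in> T \<Longrightarrow> g t x \<le> 0" and fin: "\<And>t. t \<in> T \<Longrightarrow> \<bar>g t x\<bar> \<noteq> \<infinity>"
    and c: "c > 0" and \<epsilon>: "\<epsilon> \<ge> 0"
    and neg: "\<And>t. t \<in> eps_active_set T g x \<epsilon> \<Longrightarrow> blinfun_apply (Dg t) d \<le> - c"
    and k: "k \<in> convex_cone hull (Dg ` eps_active_set T g x \<epsilon>)"
  shows "\<exists>r. (k, r) \<in> convex_cone hull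
      ((\<lambda>t. (Dg t, blinfun_apply (Dg t) x - real_of_ereal (g t x))) ` T) \<and>
    blinfun_apply k x \<le> r \<and> r \<le> blinfun_apply k x - \<epsilon> / c * blinfun_apply k d"
  (is "\<exists>r. (k, r) \<in> ?Q \<and> _ \<and> _")
proof -
  define P where "P k \<longleftrightarrow> (\<exists>r. (k, r) \<in> ?Q \<and> blinfun_apply k x \<le> r \<and>
    r \<le> blinfun_apply k x - \<epsilon> / c * blinfun_apply k d)" for k
  have "P k"
  proof (rule hull_induct[OF k])
    fix k assume "k \<in> Dg ` eps_active_set T g x \<epsilon>"
    then obtain t where t: "t \<in> eps_active_set T g x \<epsilon>" "k = Dg t" by blast
    then have tT: "t \<in> T" by (simp add: eps_active_set_def)
    obtain s where s: "g t x = ereal s" using fin[OF tT] by (cases "g t x") auto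
    have s0: "s \<le> 0" "- s \<le> \<epsilon>" using gx[OF tT] t(1) s by (auto simp: eps_active_set_def)
    have "\<epsilon> / c * blinfun_apply k d \<le> \<epsilon> / c * (- c)"
      using neg[OF t(1)] t(2) \<epsilon> c by (intro mult_left_mono) auto
    then have "\<epsilon> \<le> - (\<epsilon> / c * blinfun_apply k d)" using c by simp
    moreover have "(k, blinfun_apply k x - s) \<in> ?Q"
      using tT by (intro hull_inc) (auto simp: t(2) s intro!: image_eqI[of _ _ t])
    ultimately show "P k"
      unfolding P_def using s0 by (intro exI[of _ "blinfun_apply k x - s"]) auto
  next
    show "convex_cone {k. P k}"
      unfolding convex_cone_iff
    proof (intro conjI ballI allI impI; unfold mem_Collect_eq)
      show "P 0"
        unfolding P_def using convex_cone_hull_contains_0[of "(\<lambda>t. (Dg t, blinfun_apply (Dg t) x - real_of_ereal (g t x))) ` T"]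
        by (intro exI[of _ 0]) (simp add: zero_prod_def)
    next
      fix k k'
      assume "P k" "P k'"
      then obtain r r' where r: "(k, r) \<in> ?Q" "blinfun_apply k x \<le> r" "r \<le> blinfun_apply k x - \<epsilon> / c * blinfun_apply k d"
        "(k', r') \<in> ?Q" "blinfun_apply k' x \<le> r'" "r' \<le> blinfun_apply k' x - \<epsilon> / c * blinfun_apply k' d"
        unfolding P_def by blast
      then have "(k + k', r + r') \<in> ?Q" using convex_cone_hull_add[OF r(1,4)] by simp
      then show "P (k + k')"
        unfolding P_def using r by (intro exI[of _ "r + r'"]) (simp add: blinfun.add_left distrib_left)
    next
      fix k and a :: real
      assume "P k" and a: "0 \<le> a"
      then obtain r where r: "(k, r) \<in> ?Q" "blinfun_apply k x \<le> r" "r \<le> blinfun_apply k x - \<epsilon> / c * blinfun_apply k d"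
        unfolding P_def by blast
      then have "(a *\<^sub>R k, a * r) \<in> ?Q" using convex_cone_hull_mul[OF r(1) a] by simp
      then show "P (a *\<^sub>R k)"
        unfolding P_def using mult_left_mono[OF r(2) a] mult_left_mono[OF r(3) a]
        by (intro exI[of _ "a * r"]) (simp add: blinfun.scaleR_left algebra_simps)
    qed
  qed
  then show ?thesis by (simp add: P_def)
qed

text \<open>
  Conic combinations \<open>k\<close> of \<open>\<epsilon>\<close>-active gradients that approximate \<open>v\<close> at the two points \<open>d\<close>
  (the Slater direction) and \<open>x\<close> have lifts whose second component differs from \<open>v x\<close> by at most the error at \<open>x\<close> plus a multiple of
  \<open>\<epsilon>\<close> that does not depend on \<open>k\<close>. Hence the pair is in the closure of the constraint cone, which
  is the cone itself.
\<close>

lemma asymptotic_multiplier_in_closed_constraint_cone: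
  fixes x :: "'a::real_normed_vector"
  assumes gx: "\<And>t. t \<in> T \<Longrightarrow> g t x \<le> 0" and fin: "\<And>t. t \<in> T \<Longrightarrow> \<bar>g t x\<bar> \<noteq> \<infinity>"
    and cq: "PMFCQ T g Dg Dh x" and nf: "NFMCQ T g Dg x"
    and v: "\<And>\<epsilon>. \<epsilon> > 0 \<Longrightarrow> v \<in> weak_star closure_of (convex_cone hull (Dg ` eps_active_set T g x \<epsilon>))"
  shows "(v, blinfun_apply v x) \<in> convex_cone hull
      ((\<lambda>t. (Dg t, blinfun_apply (Dg t) x - real_of_ereal (g t x))) ` T)"
  (is "_ \<in> ?Q")
proof -
  obtain d \<epsilon>0 c where d: "\<epsilon>0 > 0" "c > 0"
    "\<And>t. t \<in> eps_active_set T g x \<epsilon>0 \<Longrightarrow> blinfun_apply (Dg t) d \<le> - c"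
    using PMFCQ_slater_direction[OF cq] by metis
  have "(v, blinfun_apply v x) \<in> prod_topology weak_star euclideanreal closure_of ?Q"
    unfolding in_closure_of
  proof (intro conjI allI impI; (elim conjE)?)
    show "(v, blinfun_apply v x) \<in> topspace (prod_topology weak_star euclideanreal)"
      by (simp add: strong_operator_topology_topspace)
    fix W assume "(v, blinfun_apply v x) \<in> W" "openin (prod_topology weak_star euclideanreal) W"
    then obtain U V where U: "openin weak_star U" "v \<in> U" and V: "open V" "blinfun_apply v x \<in> V"
      and UV: "U \<times> V \<subseteq> W"
      unfolding openin_prod_topology_alt by (metis open_openin)
    obtain e where e: "e > 0" "\<And>r. \<bar>r - blinfun_apply v x\<bar> < e \<Longrightarrow> r \<in> V"
      using V by (metis open_dist dist_real_def)
    define m where "m = \<bar>blinfun_apply v d\<bar> + 1"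
    have m: "m > 0" by (simp add: m_def add_nonneg_pos)
    \<comment> \<open>The tolerance \<open>e\<close> is shared equally between the error at \<open>x\<close> and the slack, which is at
      most \<open>\<epsilon> * m / c\<close> as soon as \<open>k d\<close> differs from \<open>v d\<close> by less than \<open>1\<close>.\<close>
    define \<epsilon> where "\<epsilon> = min \<epsilon>0 (c * e / (2 * m))"
    have \<epsilon>: "\<epsilon> > 0" using d e m by (simp add: \<epsilon>_def)
    have \<epsilon>m: "\<epsilon> / c * m \<le> e / 2"
    proof -
      have "\<epsilon> \<le> c * e / (2 * m)" by (simp add: \<epsilon>_def)
      then show ?thesis using d(2) m by (simp add: field_simps)
    qed
    define U' where "U' = U \<inter> {w. blinfun_apply w d \<in> ball (blinfun_apply v d) 1} \<inter>
      {w. blinfun_apply w x \<in> ball (blinfun_apply v x) (e / 2)}"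
    have nhd: "openin weak_star {w. blinfun_apply w p \<in> ball (blinfun_apply v p) s}" for p s
      using strong_operator_topology_basis[of "{()}" "\<lambda>_. ball (blinfun_apply v p) s" "\<lambda>_. p"] by simp
    then have "openin weak_star U'" unfolding U'_def using U(1) by (intro openin_Int nhd)
    moreover have "v \<in> U'" using U(2) e(1) by (simp add: U'_def)
    ultimately obtain k where k: "k \<in> convex_cone hull (Dg ` eps_active_set T g x \<epsilon>)" "k \<in> U'"
      using v[OF \<epsilon>] unfolding in_closure_of by blast
    have "blinfun_apply (Dg t) d \<le> - c" if "t \<in> eps_active_set T g x \<epsilon>" for t
      using that eps_active_set_mono[of \<epsilon> \<epsilon>0 T g x] d(3) by (auto simp: \<epsilon>_def)
    from constraint_cone_slack[OF gx fin d(2) less_imp_le[OF \<epsilon>] this k(1)]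
    obtain r where r: "(k, r) \<in> ?Q" "blinfun_apply k x \<le> r"
      "r \<le> blinfun_apply k x - \<epsilon> / c * blinfun_apply k d" by blast
    have kU: "k \<in> U" "\<bar>blinfun_apply v d - blinfun_apply k d\<bar> < 1"
      "\<bar>blinfun_apply v x - blinfun_apply k x\<bar> < e / 2"
      using k(2) by (auto simp: U'_def dist_real_def)
    have "\<epsilon> / c * (- blinfun_apply k d) \<le> \<epsilon> / c * m"
      using kU(2) \<epsilon> d(2) by (intro mult_left_mono) (auto simp: m_def)
    then have "- (\<epsilon> / c * blinfun_apply k d) \<le> e / 2"
      unfolding mult_minus_right using \<epsilon>m by (rule order_trans)
    then have "\<bar>r - blinfun_apply v x\<bar> < e" using r(2,3) kU(3) by linarith
    then have "(k, r) \<in> W" using kU(1) UV e(2) by blast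
    then show "\<exists>y. y \<in> ?Q \<and> y \<in> W" using r(1) by blast
  qed
  then show ?thesis using nf by (simp add: NFMCQ_def closure_of_closedin)
qed

lemma convex_cone_hull_image_finite_sum:
  fixes F :: "'t \<Rightarrow> 'v::real_vector"
  assumes "x \<in> convex_cone hull (F ` T)"
  obtains l where "\<And>t. 0 \<le> l t" "finite {t \<in> T. l t \<noteq> 0}" "x = (\<Sum>t\<in>{t \<in> T. l t \<noteq> 0}. l t *\<^sub>R F t)"
proof -
  define P where "P x \<longleftrightarrow> (\<exists>S l. finite S \<and> S \<subseteq> T \<and> (\<forall>t. 0 \<le> l t) \<and> (\<forall>t. t \<notin> S \<longrightarrow> l t = 0) \<and>
    x = (\<Sum>t\<in>S. l t *\<^sub>R F t))" for x
  have "P x"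
  proof (rule hull_induct[OF assms])
    fix y assume "y \<in> F ` T"
    then obtain t where "t \<in> T" "y = F t" by blast
    then show "P y" unfolding P_def
      by (intro exI[of _ "{t}"] exI[of _ "\<lambda>s. if s = t then 1 else 0"]) auto
  next
    show "convex_cone {x. P x}"
      unfolding convex_cone_iff
    proof (intro conjI ballI allI impI; unfold mem_Collect_eq)
      show "P 0" unfolding P_def by (intro exI[of _ "{}"] exI[of _ "\<lambda>_. 0"]) auto
    next
      fix y z assume "P y" "P z"
      obtain S l where 1: "finite S" "S \<subseteq> T" "\<forall>t. 0 \<le> l t" "\<forall>t. t \<notin> S \<longrightarrow> l t = 0"
          "y = (\<Sum>t\<in>S. l t *\<^sub>R F t)"
        using \<open>P y\<close> unfolding P_def by blast
      obtain S' l' where 2: "finite S'" "S' \<subseteq> T" "\<forall>t. 0 \<le> l' t" "\<forall>t. t \<notin> S' \<longrightarrow> l' t = 0"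
          "z = (\<Sum>t\<in>S'. l' t *\<^sub>R F t)"
        using \<open>P z\<close> unfolding P_def by blast
      have "y = (\<Sum>t\<in>S \<union> S'. l t *\<^sub>R F t)" "z = (\<Sum>t\<in>S \<union> S'. l' t *\<^sub>R F t)"
        unfolding 1(5) 2(5) using 1 2 by (auto intro!: sum.mono_neutral_left)
      then have "y + z = (\<Sum>t\<in>S \<union> S'. (l t + l' t) *\<^sub>R F t)"
        by (simp add: scaleR_add_left sum.distrib)
      then show "P (y + z)" unfolding P_def using 1 2
        by (intro exI[of _ "S \<union> S'"] exI[of _ "\<lambda>t. l t + l' t"]) auto
    next
      fix y and c :: real assume "P y" "0 \<le> c"
      then obtain S l where "finite S" "S \<subseteq> T" "\<forall>t. 0 \<le> l t" "\<forall>t. t \<notin> S \<longrightarrow> l t = 0"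
          "y = (\<Sum>t\<in>S. l t *\<^sub>R F t)" unfolding P_def by blast
      with \<open>0 \<le> c\<close> show "P (c *\<^sub>R y)" unfolding P_def
        by (intro exI[of _ S] exI[of _ "\<lambda>t. c * l t"]) (auto simp: scaleR_sum_right)
    qed
  qed
  then obtain S l where S: "finite S" "S \<subseteq> T" "\<forall>t. 0 \<le> l t" "\<forall>t. t \<notin> S \<longrightarrow> l t = 0"
          "x = (\<Sum>t\<in>S. l t *\<^sub>R F t)" unfolding P_def by blast
  then have sub: "{t \<in> T. l t \<noteq> 0} \<subseteq> S" by auto
  show ?thesis
  proof (rule that[of l])
    show "finite {t \<in> T. l t \<noteq> 0}" using sub S(1) by (rule finite_subset)
    show "x = (\<Sum>t\<in>{t \<in> T. l t \<noteq> 0}. l t *\<^sub>R F t)"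
      unfolding S(5) using S sub by (intro sum.mono_neutral_right) auto
  qed (use S(3) in simp)
qed

text \<open>
  Comparing second components gives \<open>(\<Sum>t. l t g t x) = 0\<close>, a sum of nonpositive terms, so
  every index with positive weight is active.
\<close>

lemma complementary_multipliers:
  fixes x :: "'a::real_normed_vector"
  assumes gx: "\<And>t. t \<in> T \<Longrightarrow> g t x \<le> 0" and fin: "\<And>t. t \<in> T \<Longrightarrow> \<bar>g t x\<bar> \<noteq> \<infinity>"
    and v: "(v, blinfun_apply v x) \<in> convex_cone hull
      ((\<lambda>t. (Dg t, blinfun_apply (Dg t) x - real_of_ereal (g t x))) ` T)"
  obtains l where "l \<in> nonneg_finite_multipliers T"
    "v = (\<Sum>t\<in>{t \<in> active_set T g x. l t \<noteq> 0}. l t *\<^sub>R Dg t)"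
proof (rule convex_cone_hull_image_finite_sum[OF v])
  fix l assume l: "\<And>t. 0 \<le> l t" "finite {t \<in> T. l t \<noteq> 0}"
    "(v, blinfun_apply v x) = (\<Sum>t\<in>{t \<in> T. l t \<noteq> 0}.
       l t *\<^sub>R (Dg t, blinfun_apply (Dg t) x - real_of_ereal (g t x)))"
  define \<gamma> where "\<gamma> t = real_of_ereal (g t x)" for t
  define S where "S = {t \<in> T. l t \<noteq> 0}"
  have v_eq: "v = (\<Sum>t\<in>S. l t *\<^sub>R Dg t)"
    using arg_cong[OF l(3), of fst] by (simp add: fst_sum S_def)
  have "blinfun_apply v x = (\<Sum>t\<in>S. l t * (blinfun_apply (Dg t) x - \<gamma> t))"
    using arg_cong[OF l(3), of snd] by (simp add: snd_sum S_def \<gamma>_def)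
  also have "\<dots> = blinfun_apply v x - (\<Sum>t\<in>S. l t * \<gamma> t)"
    by (simp add: v_eq blinfun.sum_left blinfun.scaleR_left right_diff_distrib sum_subtractf)
  finally have "(\<Sum>t\<in>S. l t * - \<gamma> t) = 0" by (simp add: sum_negf)
  moreover have "0 \<le> l t * - \<gamma> t" if "t \<in> S" for t
  proof -
    have "t \<in> T" using that by (simp add: S_def)
    then have "\<gamma> t \<le> 0" using gx fin unfolding \<gamma>_def by (cases "g t x") fastforce+
    then show ?thesis using l(1)[of t] by (simp add: mult_nonneg_nonpos)
  qed
  ultimately have zero: "\<And>t. t \<in> S \<Longrightarrow> l t * - \<gamma> t = 0"
    using sum_nonneg_eq_0_iff[of S "\<lambda>t. l t * - \<gamma> t"] l(2) by (auto simp: S_def)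
  have "g t x = 0" if t: "t \<in> S" for t
  proof -
    have "\<gamma> t = 0" "t \<in> T" using zero[OF t] t by (auto simp: S_def)
    then show ?thesis using fin[of t] unfolding \<gamma>_def by (cases "g t x") (auto simp: zero_ereal_def)
  qed
  then have "{t \<in> active_set T g x. l t \<noteq> 0} = S" by (auto simp: active_set_def S_def)
  then show thesis using that[of l] v_eq l(1,2) by (simp add: nonneg_finite_multipliers_def)
qed

theorem theorem5p1:
  fixes f :: "'a::banach \<Rightarrow> ereal"
    and T :: "'t set"
    and g :: "'t \<Rightarrow> 'a \<Rightarrow> ereal"
    and h :: "'a \<Rightarrow> 'b::banach"
    and xbar :: 'a
    and Df :: "'a \<Rightarrow>\<^sub>L real"
    and Dg :: "'t \<Rightarrow> 'a \<Rightarrow>\<^sub>L real"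
    and Dh :: "'a \<Rightarrow>\<^sub>L 'b"
  assumes "\<And>x. f x \<noteq> -\<infinity>"
    and "\<And>t x. t \<in> T \<Longrightarrow> g t x \<noteq> -\<infinity>"
    and "local_minimizer_on f (feasible_set T g h) xbar"
    and "standing_assumptions T g Dg h Dh xbar"
    and "PMFCQ T g Dg Dh xbar"
    and "uniformly_frechet_differentiable T g Dg xbar"
    and "ereal_has_frechet_derivative f Df xbar"
  shows "0 \<in> {Df}
           + (\<Inter>\<epsilon>\<in>{0<..}. weak_star closure_of
                (convex_cone hull (Dg ` eps_active_set T g xbar \<epsilon>)))
           + range (dual_adjoint Dh)
       \<and> (NFMCQ T g Dg xbar \<longrightarrow>
           (\<exists>l\<in>nonneg_finite_multipliers T. \<exists>ystar :: 'b \<Rightarrow>\<^sub>L real.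
              0 = Df + (\<Sum>t\<in>{t \<in> active_set T g xbar. l t \<noteq> 0}. l t *\<^sub>R Dg t)
                + dual_adjoint Dh ystar))"
proof (intro conjI impI)
  obtain v ystar where v: "0 = Df + v + dual_adjoint Dh ystar"
    "\<And>\<epsilon>. \<epsilon> > 0 \<Longrightarrow> v \<in> weak_star closure_of (convex_cone hull (Dg ` eps_active_set T g xbar \<epsilon>))"
    using asymptotic_multiplier_rule[OF assms(3-7)] by metis
  show "0 \<in> {Df}
           + (\<Inter>\<epsilon>\<in>{0<..}. weak_star closure_of
                (convex_cone hull (Dg ` eps_active_set T g xbar \<epsilon>)))
           + range (dual_adjoint Dh)"
    by (subst v(1)) (intro set_plus_intro; use v(2) in simp)
  assume nf: "NFMCQ T g Dg xbar"
  have gx: "g t xbar \<le> 0" if "t \<in> T" for t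
    using assms(3) that by (auto simp: local_minimizer_on_def feasible_set_def)
  have fin: "\<bar>g t xbar\<bar> \<noteq> \<infinity>" if "t \<in> T" for t
    using assms(4) that eventually_nhds_x_imp_x
    by (fastforce simp: standing_assumptions_def ereal_has_frechet_derivative_def)
  have "(v, blinfun_apply v xbar) \<in> convex_cone hull
      ((\<lambda>t. (Dg t, blinfun_apply (Dg t) xbar - real_of_ereal (g t xbar))) ` T)"
    by (rule asymptotic_multiplier_in_closed_constraint_cone[OF _ _ assms(5) nf])
       (use gx fin v(2) in auto)
  then obtain l where "l \<in> nonneg_finite_multipliers T"
    "v = (\<Sum>t\<in>{t \<in> active_set T g xbar. l t \<noteq> 0}. l t *\<^sub>R Dg t)"
    using complementary_multipliers[where T = T and g = g and x = xbar and v = v and Dg = Dg] gx fin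
    by blast
  with v(1) show "\<exists>l\<in>nonneg_finite_multipliers T. \<exists>ystar :: 'b \<Rightarrow>\<^sub>L real.
              0 = Df + (\<Sum>t\<in>{t \<in> active_set T g xbar. l t \<noteq> 0}. l t *\<^sub>R Dg t)
                + dual_adjoint Dh ystar" by blast
qed


end
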